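(* Let $\mathfrak g$ be a non-abelian four dimensional Kähler Lie algebra with complex structure $J$. Then $(\mathfrak g,J)$ is equivalent to one of the following Lie algebras with a complex structure, and for each of these the compatible symplectic forms are exactly the ones listed (with real parameters $a,b,c$): 1. $\mathbb R\times\mathfrak h_3$: $Je_1=e_2$, $Je_3=e_4$; $\omega=a(e^{13}+e^{24})+b(e^{14}-e^{23})+c\,e^{12}$, $a^2+b^2\neq0$. 2. $\mathbb R^2\times\mathfrak{aff}(\mathbb R)$: $Je_1=e_2$, $Je_3=e_4$; $\omega=a\,e^{12}+b\,e^{34}$, $ab\neq0$. 3. $\mathbb R\times\mathfrak e(2)$: $Je_1=e_4$, $Je_2=e_3$; $\omega=a\,e^{14}+b\,e^{23}$, $ab\ne0$. 4. $\mathfrak{aff}(\mathbb R)\times\mathfrak{aff}(\mathbb R)$: $Je_1=e_2$, $Je_3=e_4$; $\omega=a\,e^{12}+b\,e^{34}$, $ab\neq0$. 5. $\mathfrak{aff}(\mathbb C)$: either $J_1e_1=e_3$, $J_1e_2=e_4$; $\omega=a(e^{13}-e^{24})+b(e^{14}+e^{23})$, $a^2+b^2\neq0$; or $J_2e_1=-e_2$, $J_2e_3=e_4$; $\omega=a(e^{13}-e^{24})+b(e^{14}+e^{23})+c\,e^{12}$, $a^2+b^2\ne0$. 6. $\mathfrak r_{4,-1,-1}$: $Je_4=e_1$, $Je_2=e_3$; $\omega=a(e^{12}+e^{34})+b(e^{13}-e^{24})+c\,e^{14}$, $a^2+b^2\neq0$. 7. $\mathfrak r'_{4,0,\delta}$,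 $\delta>0$: either $J_1e_4=e_1$, $J_1e_2=e_3$, or $J_2e_4=e_1$, $J_2e_2=-e_3$; in both cases $\omega=a\,e^{14}+b\,e^{23}$, $ab\ne0$. 8. $\mathfrak d_{4,1}$: $Je_1=e_4$, $Je_2=e_3$; $\omega=a(e^{12}-e^{34})+b\,e^{14}$, $a\neq0$. 9. $\mathfrak d_{4,2}$: either $J_1e_4=-e_2$, $J_1e_1=e_3$; $\omega=a(e^{14}+e^{23})+b\,e^{24}$, $a\ne0$; or $J_2e_4=-2e_1$, $J_2e_2=e_3$; $\omega=a\,e^{14}+b\,e^{23}$, $ab\neq0$. 10. $\mathfrak d_{4,1/2}$: either $J_1e_4=e_3$, $J_1e_1=e_2$, or $J_2e_4=e_3$, $J_2e_1=-e_2$; in both cases $\omega=a(e^{12}-e^{34})$, $a\neq0$. 11. $\mathfrak d'_{4,\delta}$, $\delta>0$: one of $J_1e_4=e_3$, $J_1e_1=e_2$; $J_2e_4=-e_3$, $J_2e_1=e_2$; $J_3e_4=-e_3$, $J_3e_1=-e_2$; $J_4e_4=e_3$, $J_4e_1=-e_2$; in all cases $\omega=a(e^{12}-\delta e^{34})$, $a\ne0$.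
   Context: All Lie algebras are real. A complex structure on $\mathfrak g$ is an endomorphism $J$ with $J^2=-I$ and $[Jx,Jy]-[x,y]-J[Jx,y]-J[x,Jy]=0$ for all $x,y$. A symplectic structure is a closed nondegenerate 2-form $\omega$ on $\mathfrak g$ (closed: $\omega([x,y],z)+\omega([y,z],x)+\omega([z,x],y)=0$); it is compatible with $J$ if $\omega(Jx,Jy)=\omega(x,y)$ for all $x,y$. A Kähler Lie algebra is a Lie algebra endowed with a compatible pair $(J,\omega)$. $(\mathfrak g_1,J_1)$ and $(\mathfrak g_2,J_2)$ are equivalent if there is a Lie algebra isomorphism $\alpha:\mathfrak g_1\to\mathfrak g_2$ with $J_2\alpha=\alpha J_1$. $\{e^i\}$ is the basis dual to $\{e_i\}$ and $e^{ij}=e^i\wedge e^j$. Each $J$ listed is determined by the two given values and $J^2=-I$. The Lie algebras have basis $e_1,\dots,e_4$ and nonzero brackets: $\mathbb R\times\mathfrak h_3$: $[e_1,e_2]=e_3$. $\mathbb R^2\times\mathfrak{aff}(\mathbb R)$: $[e_1,e_2]=e_2$. $\mathbb R\times\mathfrak e(2)$: $[e_1,e_2]=-e_3$, $[e_1,e_3]=e_2$. $\mathfrak{aff}(\mathbb R)\times\mathfrak{aff}(\mathbb R)$: $[e_1,e_2]=e_2$, $[e_3,e_4]=e_4$. $\mathfrak{aff}(\mathbb C)$: $[e_1,e_3]=e_3$, $[e_1,e_4]=e_4$, $[e_2,e_3]=e_4$, $[e_2,e_4]=-e_3$. $\mathfrak r_{4,-1,-1}$: $[e_4,e_1]=e_1$,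 $[e_4,e_2]=-e_2$, $[e_4,e_3]=-e_3$. $\mathfrak r'_{4,0,\delta}$: $[e_4,e_1]=e_1$, $[e_4,e_2]=-\delta e_3$, $[e_4,e_3]=\delta e_2$. $\mathfrak d_{4,\lambda}$: $[e_1,e_2]=e_3$, $[e_4,e_3]=e_3$, $[e_4,e_1]=\lambda e_1$, $[e_4,e_2]=(1-\lambda)e_2$. $\mathfrak d'_{4,\delta}$: $[e_1,e_2]=e_3$, $[e_4,e_1]=\frac\delta2e_1-e_2$, $[e_4,e_3]=\delta e_3$, $[e_4,e_2]=e_1+\frac\delta2e_2$. *)

theory Defs
  imports "HOL-Analysis.Analysis"
begin

section \<open>Lie algebras, complex and symplectic structures\<close>

definition lie_algebra :: "('a::real_vector \<Rightarrow> 'a \<Rightarrow> 'a) \<Rightarrow> bool" where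
  "lie_algebra br \<longleftrightarrow>
     bilinear br \<and>
     (\<forall>x. br x x = 0) \<and>
     (\<forall>x y z. br x (br y z) + br y (br z x) + br z (br x y) = 0)"

definition abelian :: "('a::real_vector \<Rightarrow> 'a \<Rightarrow> 'a) \<Rightarrow> bool" where
  "abelian br \<longleftrightarrow> (\<forall>x y. br x y = 0)"

definition complex_structure ::
  "('a::real_vector \<Rightarrow> 'a \<Rightarrow> 'a) \<Rightarrow> ('a \<Rightarrow> 'a) \<Rightarrow> bool" where
  "complex_structure br J \<longleftrightarrow>
     linear J \<and>
     (\<forall>x. J (J x) = - x) \<and>
     (\<forall>x y. br (J x) (J y) - br x y - J (br (J x) y) - J (br x (J y)) = 0)"

definition symplectic_structure ::
  "('a::real_vector \<Rightarrow> 'a \<Rightarrow> 'a) \<Rightarrow> ('a \<Rightarrow> 'a \<Rightarrow> real) \<Rightarrow> bool" where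
  "symplectic_structure br \<omega> \<longleftrightarrow>
     bilinear \<omega> \<and>
     (\<forall>x. \<omega> x x = 0) \<and>
     (\<forall>x. x \<noteq> 0 \<longrightarrow> (\<exists>y. \<omega> x y \<noteq> 0)) \<and>
     (\<forall>x y z. \<omega> (br x y) z + \<omega> (br y z) x + \<omega> (br z x) y = 0)"

definition compatible :: "('a \<Rightarrow> 'a) \<Rightarrow> ('a \<Rightarrow> 'a \<Rightarrow> real) \<Rightarrow> bool" where
  "compatible J \<omega> \<longleftrightarrow> (\<forall>x y. \<omega> (J x) (J y) = \<omega> x y)"

text \<open>No definiteness of the metric \<open>\<omega> (J x) y\<close> is required: these are the structures
  often called pseudo-Kaehler.\<close>

definition kaehler ::
  "('a::real_vector \<Rightarrow> 'a \<Rightarrow> 'a) \<Rightarrow> ('a \<Rightarrow> 'a) \<Rightarrow> ('a \<Rightarrow> 'a \<Rightarrow> real) \<Rightarrow> bool" where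
  "kaehler br J \<omega> \<longleftrightarrow>
     lie_algebra br \<and> complex_structure br J \<and> symplectic_structure br \<omega> \<and> compatible J \<omega>"

definition equivalent ::
  "('a::real_vector \<Rightarrow> 'a \<Rightarrow> 'a) \<Rightarrow> ('a \<Rightarrow> 'a) \<Rightarrow>
   ('b::real_vector \<Rightarrow> 'b \<Rightarrow> 'b) \<Rightarrow> ('b \<Rightarrow> 'b) \<Rightarrow> bool" where
  "equivalent br1 J1 br2 J2 \<longleftrightarrow>
     (\<exists>\<alpha>. linear \<alpha> \<and> bij \<alpha> \<and>
          (\<forall>x y. \<alpha> (br1 x y) = br2 (\<alpha> x) (\<alpha> y)) \<and>
          (\<forall>x. J2 (\<alpha> x) = \<alpha> (J1 x)))"

section \<open>The model Lie algebras\<close>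

text \<open>The models live on \<^typ>\<open>real^4\<close>. The index type \<^typ>\<open>4\<close> is arithmetic modulo 4;
  the indices are written 1, 2, 3, 4.\<close>

abbreviation e :: "4 \<Rightarrow> real^4" where
  "e i \<equiv> axis i 1"

text \<open>The 2-form \<open>e\<^sup>i \<and> e\<^sup>j\<close>, the dual basis being the coordinate functions.\<close>

definition ew :: "4 \<Rightarrow> 4 \<Rightarrow> real^4 \<Rightarrow> real^4 \<Rightarrow> real" where
  "ew i j x y = x $ i * y $ j - x $ j * y $ i"

text \<open>The skew-symmetric bilinear map with \<open>[e\<^sub>i, e\<^sub>j] = v\<close> that vanishes on all other pairs
  of basis vectors (up to order) is \<open>ew i j x y *\<^sub>R v\<close>; the brackets below are sums of such
  terms, one for each nonzero structure constant.\<close>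

definition br_rh3 :: "real^4 \<Rightarrow> real^4 \<Rightarrow> real^4" where
  "br_rh3 x y = ew 1 2 x y *\<^sub>R e 3"

definition br_rr_aff :: "real^4 \<Rightarrow> real^4 \<Rightarrow> real^4" where
  "br_rr_aff x y = ew 1 2 x y *\<^sub>R e 2"

definition br_re2 :: "real^4 \<Rightarrow> real^4 \<Rightarrow> real^4" where
  "br_re2 x y = ew 1 2 x y *\<^sub>R (- e 3) + ew 1 3 x y *\<^sub>R e 2"

definition br_aff_aff :: "real^4 \<Rightarrow> real^4 \<Rightarrow> real^4" where
  "br_aff_aff x y = ew 1 2 x y *\<^sub>R e 2 + ew 3 4 x y *\<^sub>R e 4"

definition br_affC :: "real^4 \<Rightarrow> real^4 \<Rightarrow> real^4" where
  "br_affC x y =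
     ew 1 3 x y *\<^sub>R e 3 + ew 1 4 x y *\<^sub>R e 4 +
     ew 2 3 x y *\<^sub>R e 4 + ew 2 4 x y *\<^sub>R (- e 3)"

text \<open>\<open>\<rr>\<^bsub>4,-1,-1\<^esub>\<close>\<close>

definition br_r4 :: "real^4 \<Rightarrow> real^4 \<Rightarrow> real^4" where
  "br_r4 x y =
     ew 4 1 x y *\<^sub>R e 1 + ew 4 2 x y *\<^sub>R (- e 2) + ew 4 3 x y *\<^sub>R (- e 3)"

text \<open>\<open>\<rr>'\<^bsub>4,0,\<delta>\<^esub>\<close>\<close>

definition br_r4' :: "real \<Rightarrow> real^4 \<Rightarrow> real^4 \<Rightarrow> real^4" where
  "br_r4' \<delta> x y =
     ew 4 1 x y *\<^sub>R e 1 + ew 4 2 x y *\<^sub>R ((- \<delta>) *\<^sub>R e 3) + ew 4 3 x y *\<^sub>R (\<delta> *\<^sub>R e 2)"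

text \<open>\<open>\<dd>\<^bsub>4,\<lambda>\<^esub>\<close>\<close>

definition br_d4 :: "real \<Rightarrow> real^4 \<Rightarrow> real^4 \<Rightarrow> real^4" where
  "br_d4 l x y =
     ew 1 2 x y *\<^sub>R e 3 + ew 4 3 x y *\<^sub>R e 3 +
     ew 4 1 x y *\<^sub>R (l *\<^sub>R e 1) + ew 4 2 x y *\<^sub>R ((1 - l) *\<^sub>R e 2)"

text \<open>\<open>\<dd>'\<^bsub>4,\<delta>\<^esub>\<close>\<close>

definition br_d4' :: "real \<Rightarrow> real^4 \<Rightarrow> real^4 \<Rightarrow> real^4" where
  "br_d4' \<delta> x y =
     ew 1 2 x y *\<^sub>R e 3 + ew 4 1 x y *\<^sub>R ((\<delta> / 2) *\<^sub>R e 1 - e 2) +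
     ew 4 3 x y *\<^sub>R (\<delta> *\<^sub>R e 3) + ew 4 2 x y *\<^sub>R (e 1 + (\<delta> / 2) *\<^sub>R e 2)"

section \<open>The endomorphism determined by two values and \<open>J\<^sup>2 = -I\<close>\<close>

definition J_of :: "4 \<Rightarrow> real^4 \<Rightarrow> 4 \<Rightarrow> real^4 \<Rightarrow> real^4 \<Rightarrow> real^4" where
  "J_of i u j v = (THE J. linear J \<and> (\<forall>x. J (J x) = - x) \<and> J (e i) = u \<and> J (e j) = v)"

text \<open>The definite description is meaningful in all cases used below: there \<open>u\<close> and \<open>v\<close>
  are nonzero multiples of the two remaining basis vectors.\<close>

lemma J_of_ex1:
  fixes i j k l :: 4 and s t :: real
  assumes U: "{i, j, k, l} = UNIV" and st: "s \<noteq> 0" "t \<noteq> 0"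
  shows "\<exists>!J. linear J \<and> (\<forall>x. J (J x) = - x) \<and> J (e i) = s *\<^sub>R e k \<and> J (e j) = t *\<^sub>R e l"
proof -
  have "card {i, j, k, l} = 4" using U by simp
  then have dist: "i \<noteq> j" "i \<noteq> k" "i \<noteq> l" "j \<noteq> k" "j \<noteq> l" "k \<noteq> l"
    by (auto simp: card_insert_if split: if_splits)
  have ex: "x = x$i *\<^sub>R e i + x$j *\<^sub>R e j + x$k *\<^sub>R e k + x$l *\<^sub>R e l" for x :: "real^4"
  proof -
    have "m = i \<or> m = j \<or> m = k \<or> m = l" for m using U by auto
    then show ?thesis using dist by (subst vec_eq_iff) (force simp: axis_def)
  qed
  define J where "J x = x$i *\<^sub>R (s *\<^sub>R e k) + x$j *\<^sub>R (t *\<^sub>R e l)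
      + x$k *\<^sub>R ((-1/s) *\<^sub>R e i) + x$l *\<^sub>R ((-1/t) *\<^sub>R e j)" for x :: "real^4"
  have "linear J"
    by (rule linearI) (simp_all add: J_def algebra_simps add_divide_distrib)
  moreover have "J (J x) = - x" for x
    using st dist by (subst (3) ex) (simp add: J_def axis_def algebra_simps)
  moreover have "J (e i) = s *\<^sub>R e k" "J (e j) = t *\<^sub>R e l"
    using dist by (simp_all add: J_def axis_def)
  moreover have "K = J"
    if K: "linear K" "\<forall>x. K (K x) = - x" "K (e i) = s *\<^sub>R e k" "K (e j) = t *\<^sub>R e l" for K
  proof
    fix x
    have "s *\<^sub>R K (e k) = - e i" "t *\<^sub>R K (e l) = - e j"
      using K by (metis linear_scale)+
    then have "(1/s) *\<^sub>R (s *\<^sub>R K (e k)) = (-1/s) *\<^sub>R e i"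
        "(1/t) *\<^sub>R (t *\<^sub>R K (e l)) = (-1/t) *\<^sub>R e j" by simp_all
    then have kl: "K (e k) = (-1/s) *\<^sub>R e i" "K (e l) = (-1/t) *\<^sub>R e j"
      using st by simp_all
    show "K x = J x"
      by (subst ex) (simp only: linear_add[OF K(1)] linear_scale[OF K(1)] K(3,4) kl J_def)
  qed
  ultimately show ?thesis by blast
qed

section \<open>The list\<close>

text \<open>\<open>kaehler_model br J \<Omega>\<close>: the pair \<open>(br, J)\<close> is in the list, and \<open>\<Omega>\<close> is the family of
  2-forms listed for it.\<close>

inductive kaehler_model ::
  "(real^4 \<Rightarrow> real^4 \<Rightarrow> real^4) \<Rightarrow> (real^4 \<Rightarrow> real^4) \<Rightarrow> (real^4 \<Rightarrow> real^4 \<Rightarrow> real) set \<Rightarrow> bool"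
where
  rh3: "kaehler_model br_rh3 (J_of 1 (e 2) 3 (e 4))
     {(\<lambda>x y. a * (ew 1 3 x y + ew 2 4 x y) + b * (ew 1 4 x y - ew 2 3 x y) + c * ew 1 2 x y)
       | a b c. a^2 + b^2 \<noteq> 0}"
| rr_aff: "kaehler_model br_rr_aff (J_of 1 (e 2) 3 (e 4))
     {(\<lambda>x y. a * ew 1 2 x y + b * ew 3 4 x y) | a b. a * b \<noteq> 0}"
| re2: "kaehler_model br_re2 (J_of 1 (e 4) 2 (e 3))
     {(\<lambda>x y. a * ew 1 4 x y + b * ew 2 3 x y) | a b. a * b \<noteq> 0}"
| aff_aff: "kaehler_model br_aff_aff (J_of 1 (e 2) 3 (e 4))
     {(\<lambda>x y. a * ew 1 2 x y + b * ew 3 4 x y) | a b. a * b \<noteq> 0}"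
| affC_1: "kaehler_model br_affC (J_of 1 (e 3) 2 (e 4))
     {(\<lambda>x y. a * (ew 1 3 x y - ew 2 4 x y) + b * (ew 1 4 x y + ew 2 3 x y))
       | a b. a^2 + b^2 \<noteq> 0}"
| affC_2: "kaehler_model br_affC (J_of 1 (- e 2) 3 (e 4))
     {(\<lambda>x y. a * (ew 1 3 x y - ew 2 4 x y) + b * (ew 1 4 x y + ew 2 3 x y) + c * ew 1 2 x y)
       | a b c. a^2 + b^2 \<noteq> 0}"
| r4: "kaehler_model br_r4 (J_of 4 (e 1) 2 (e 3))
     {(\<lambda>x y. a * (ew 1 2 x y + ew 3 4 x y) + b * (ew 1 3 x y - ew 2 4 x y) + c * ew 1 4 x y)
       | a b c. a^2 + b^2 \<noteq> 0}"
| r4'_1: "\<delta> > 0 \<Longrightarrow> kaehler_model (br_r4' \<delta>) (J_of 4 (e 1) 2 (e 3))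
     {(\<lambda>x y. a * ew 1 4 x y + b * ew 2 3 x y) | a b. a * b \<noteq> 0}"
| r4'_2: "\<delta> > 0 \<Longrightarrow> kaehler_model (br_r4' \<delta>) (J_of 4 (e 1) 2 (- e 3))
     {(\<lambda>x y. a * ew 1 4 x y + b * ew 2 3 x y) | a b. a * b \<noteq> 0}"
| d4_one: "kaehler_model (br_d4 1) (J_of 1 (e 4) 2 (e 3))
     {(\<lambda>x y. a * (ew 1 2 x y - ew 3 4 x y) + b * ew 1 4 x y) | a b. a \<noteq> 0}"
| d4_two_1: "kaehler_model (br_d4 2) (J_of 4 (- e 2) 1 (e 3))
     {(\<lambda>x y. a * (ew 1 4 x y + ew 2 3 x y) + b * ew 2 4 x y) | a b. a \<noteq> 0}"
| d4_two_2: "kaehler_model (br_d4 2) (J_of 4 ((- 2) *\<^sub>R e 1) 2 (e 3))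
     {(\<lambda>x y. a * ew 1 4 x y + b * ew 2 3 x y) | a b. a * b \<noteq> 0}"
| d4_half_1: "kaehler_model (br_d4 (1 / 2)) (J_of 4 (e 3) 1 (e 2))
     {(\<lambda>x y. a * (ew 1 2 x y - ew 3 4 x y)) | a. a \<noteq> 0}"
| d4_half_2: "kaehler_model (br_d4 (1 / 2)) (J_of 4 (e 3) 1 (- e 2))
     {(\<lambda>x y. a * (ew 1 2 x y - ew 3 4 x y)) | a. a \<noteq> 0}"
| d4'_1: "\<delta> > 0 \<Longrightarrow> kaehler_model (br_d4' \<delta>) (J_of 4 (e 3) 1 (e 2))
     {(\<lambda>x y. a * (ew 1 2 x y - \<delta> * ew 3 4 x y)) | a. a \<noteq> 0}"
| d4'_2: "\<delta> > 0 \<Longrightarrow> kaehler_model (br_d4' \<delta>) (J_of 4 (- e 3) 1 (e 2))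
     {(\<lambda>x y. a * (ew 1 2 x y - \<delta> * ew 3 4 x y)) | a. a \<noteq> 0}"
| d4'_3: "\<delta> > 0 \<Longrightarrow> kaehler_model (br_d4' \<delta>) (J_of 4 (- e 3) 1 (- e 2))
     {(\<lambda>x y. a * (ew 1 2 x y - \<delta> * ew 3 4 x y)) | a. a \<noteq> 0}"
| d4'_4: "\<delta> > 0 \<Longrightarrow> kaehler_model (br_d4' \<delta>) (J_of 4 (e 3) 1 (- e 2))
     {(\<lambda>x y. a * (ew 1 2 x y - \<delta> * ew 3 4 x y)) | a. a \<noteq> 0}"

end

theory Submission
  imports Defs
begin

text \<open>
  Every four dimensional Lie algebra has a codimension one ideal
  \<open>h\<close> that is unimodular and contains all brackets (\<open>unimodular_ideal_exists\<close>). If the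
  functional \<open>tr ad\<close> is not zero, its kernel will do. If it is zero, then the differential
  kills all 3-forms, so \<open>d\<alpha> \<and> d\<alpha> = d(\<alpha> \<and> d\<alpha>) = 0\<close> for all 1-forms \<open>\<alpha>\<close>: the image of \<open>d\<close> is
  an isotropic subspace of the six dimensional space of 2-forms, on which the wedge product
  has signature \<open>(3,3)\<close>. Such a subspace has dimension at most 3, so some \<open>\<alpha> \<noteq> 0\<close> is closed,
  and its kernel is \<open>h\<close>.

  The intersection \<open>W = h \<inter> J h\<close> is a complex line. A nonzero \<open>w \<in> W\<close> and some \<open>z \<in> h\<close> outside
  \<open>W\<close> give a frame \<open>w, J w, z, J z\<close>. The 2-form \<open>\<omega>\<close> decides how to choose it: if \<open>W\<close> is
  nondegenerate for \<open>\<omega>\<close>, then \<open>z\<close> can be taken orthogonal to \<open>W\<close> and there is a rotation of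
  \<open>w\<close> left to spend; if \<open>W\<close> is isotropic, then all values of \<open>\<omega>\<close> on the frame can be made
  constant (\<open>normal_form_exists\<close>).

  In such a frame the integrability of \<open>J\<close> and the unimodularity of \<open>h\<close> are linear conditions
  that leave a bracket with eleven parameters (\<open>std_br\<close>). The Jacobi identity is then a
  small system of quadratic equations, and \<open>d\<omega> = 0\<close> is linear. The resulting systems are
  solved in \<open>orthogonal_solutions\<close> and \<open>isotropic_solutions\<close>, and each solution is
  carried to a model by an explicit change of frame that commutes with the complex
  structures. Most of these changes are rescalings, rotations and translations of \<open>z\<close> along
  \<open>W\<close>. They are of another kind when \<open>J\<close> exchanges two abelian planes and \<open>[J x, y]\<close> is a
  commutative associative product with unit on one of them: then the two semisimple real
  algebras of dimension two, \<open>\<real> \<oplus> \<real>\<close> and \<open>\<complex>\<close>, give \<open>aff(\<real>) \<times> aff(\<real>)\<close> and \<open>aff(\<complex>)\<close>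
  (\<open>listed_algebra\<close>).

  For a given model the compatible symplectic forms are found by linear algebra: a 2-form has
  six coefficients, it suffices to test closedness on four triples and compatibility on six
  pairs of basis vectors, and nondegeneracy is the nonvanishing of the Pfaffian
  (\<open>kaehler_forms\<close>).
\<close>

section \<open>Alternating maps and 2-forms on four-space\<close>

lemma vector_4 [simp]:
  "(vector [a, b, c, d] :: real^4) $ 1 = a" "(vector [a, b, c, d] :: real^4) $ 2 = b"
  "(vector [a, b, c, d] :: real^4) $ 3 = c" "(vector [a, b, c, d] :: real^4) $ 4 = d"
  by (simp_all add: vector_def)

lemma axis_expansion:
  "x = x$1 *\<^sub>R e 1 + x$2 *\<^sub>R e 2 + x$3 *\<^sub>R e 3 + x$4 *\<^sub>R e 4" for x :: "real^4"
  by (simp add: vec_eq_iff forall_4 axis_def)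

lemma alternating_swap:
  assumes "bilinear B" "\<And>x. B x x = 0"
  shows "B y x = - B x y"
proof -
  have "B (x + y) (x + y) = (B x x + B x y) + (B y x + B y y)"
    by (simp add: bilinear_ladd[OF assms(1)] bilinear_radd[OF assms(1)])
  then have "B x y + B y x = 0" by (simp only: assms(2) add_0 add_0_right)
  then show ?thesis by (simp add: add_eq_0_iff)
qed

lemma alternating_expansion:
  fixes B :: "real^4 \<Rightarrow> real^4 \<Rightarrow> 'b::real_vector"
  assumes B: "bilinear B" "\<And>x. B x x = 0"
  shows "B x y = ew 1 2 x y *\<^sub>R B (e 1) (e 2) + ew 1 3 x y *\<^sub>R B (e 1) (e 3)
    + ew 1 4 x y *\<^sub>R B (e 1) (e 4) + ew 2 3 x y *\<^sub>R B (e 2) (e 3)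
    + ew 2 4 x y *\<^sub>R B (e 2) (e 4) + ew 3 4 x y *\<^sub>R B (e 3) (e 4)"
proof -
  note s = alternating_swap[OF B]
  have "B x y = B (x$1 *\<^sub>R e 1 + x$2 *\<^sub>R e 2 + x$3 *\<^sub>R e 3 + x$4 *\<^sub>R e 4)
                  (y$1 *\<^sub>R e 1 + y$2 *\<^sub>R e 2 + y$3 *\<^sub>R e 3 + y$4 *\<^sub>R e 4)"
    using axis_expansion[of x] axis_expansion[of y] by simp
  also have "\<dots> = ew 1 2 x y *\<^sub>R B (e 1) (e 2) + ew 1 3 x y *\<^sub>R B (e 1) (e 3)
    + ew 1 4 x y *\<^sub>R B (e 1) (e 4) + ew 2 3 x y *\<^sub>R B (e 2) (e 3)
    + ew 2 4 x y *\<^sub>R B (e 2) (e 4) + ew 3 4 x y *\<^sub>R B (e 3) (e 4)"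
    by (simp add: bilinear_ladd[OF B(1)] bilinear_radd[OF B(1)] bilinear_lmul[OF B(1)]
        bilinear_rmul[OF B(1)] B(2) s[of "e 1" "e 2"] s[of "e 1" "e 3"] s[of "e 1" "e 4"]
        s[of "e 2" "e 3"] s[of "e 2" "e 4"] s[of "e 3" "e 4"] ew_def algebra_simps)
  finally show ?thesis .
qed

definition form6 :: "real \<Rightarrow> real \<Rightarrow> real \<Rightarrow> real \<Rightarrow> real \<Rightarrow> real \<Rightarrow> real^4 \<Rightarrow> real^4 \<Rightarrow> real" where
  "form6 a b c d p q x y = a * ew 1 2 x y + b * ew 1 3 x y + c * ew 1 4 x y
     + d * ew 2 3 x y + p * ew 2 4 x y + q * ew 3 4 x y"

lemma bilinear_form6: "bilinear (form6 a b c d p q)"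
  by (auto simp: bilinear_def linear_iff form6_def ew_def algebra_simps)

lemma form6_alt: "form6 a b c d p q x x = 0"
  by (simp add: form6_def ew_def)

text \<open>The coefficient matrix times its dual (the matrix with the complementary coefficients) is
  the Pfaffian times the identity: the rows of the dual matrix span the kernel when the
  Pfaffian is zero, and invert the matrix when it is not.\<close>

lemma form6_nondegenerate:
  "(\<forall>x. x \<noteq> 0 \<longrightarrow> (\<exists>y. form6 a b c d p q x y \<noteq> 0)) \<longleftrightarrow> a * q - b * p + c * d \<noteq> 0"
  (is "?N \<longleftrightarrow> ?pf \<noteq> 0")
proof
  assume N: ?N
  have z: "x = 0" if "\<And>y. form6 a b c d p q x y = 0" for x
    using N that by blast
  show "?pf \<noteq> 0"
  proof
    assume pf: "?pf = 0"
    have 1: "vector [0, q, - p, d] = (0 :: real^4)"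
      using pf by (intro z) (simp add: form6_def ew_def vector_def, algebra)
    have 2: "vector [- q, 0, c, - b] = (0 :: real^4)"
      using pf by (intro z) (simp add: form6_def ew_def vector_def, algebra)
    have 3: "vector [p, - c, 0, a] = (0 :: real^4)"
      using pf by (intro z) (simp add: form6_def ew_def vector_def, algebra)
    have "a = 0" "b = 0" "c = 0" "d = 0" "p = 0" "q = 0"
      using 1 2 3 by (simp_all add: vec_eq_iff forall_4)
    then have "e 1 = 0"
      by (intro z) (simp add: form6_def)
    then show False by (simp add: vec_eq_iff forall_4 axis_def)
  qed
next
  assume pf: "?pf \<noteq> 0"
  have "x = 0" if z: "\<And>y. form6 a b c d p q x y = 0" for x
  proof -
    have "form6 a b c d p q x (vector [0, q, - p, d]) = ?pf * x$1"
      "form6 a b c d p q x (vector [- q, 0, c, - b]) = ?pf * x$2"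
      "form6 a b c d p q x (vector [p, - c, 0, a]) = ?pf * x$3"
      "form6 a b c d p q x (vector [- d, b, - a, 0]) = ?pf * x$4"
      by (simp_all add: form6_def ew_def algebra_simps)
    then show ?thesis using pf by (simp add: z vec_eq_iff forall_4)
  qed
  then show ?N by blast
qed

lemma alternating_form6:
  fixes \<omega> :: "real^4 \<Rightarrow> real^4 \<Rightarrow> real"
  assumes "bilinear \<omega>" "\<And>x. \<omega> x x = 0"
  shows "\<omega> = form6 (\<omega> (e 1) (e 2)) (\<omega> (e 1) (e 3)) (\<omega> (e 1) (e 4))
                   (\<omega> (e 2) (e 3)) (\<omega> (e 2) (e 4)) (\<omega> (e 3) (e 4))"
  by (intro ext) (subst alternating_expansion[OF assms], simp add: form6_def mult.commute)

text \<open>The description in \<open>J_of\<close> determines the values on the two other basis vectors through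
  \<open>J\<^sup>2 = -I\<close>, which makes the map computable.\<close>

lemma J_of_eq:
  fixes i j k l :: 4 and s t :: real
  assumes U: "{i, j, k, l} = UNIV" and st: "s \<noteq> 0" "t \<noteq> 0"
    and u: "u = s *\<^sub>R e k" "v = t *\<^sub>R e l"
  shows "J_of i u j v = (\<lambda>x. x$i *\<^sub>R (s *\<^sub>R e k) + x$j *\<^sub>R (t *\<^sub>R e l)
      + x$k *\<^sub>R ((-1/s) *\<^sub>R e i) + x$l *\<^sub>R ((-1/t) *\<^sub>R e j))"
    (is "_ = ?J")
proof -
  have "card {i, j, k, l} = 4" using U by simp
  then have dist: "i \<noteq> j" "i \<noteq> k" "i \<noteq> l" "j \<noteq> k" "j \<noteq> l" "k \<noteq> l"
    by (auto simp: card_insert_if split: if_splits)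
  have ex: "x = x$i *\<^sub>R e i + x$j *\<^sub>R e j + x$k *\<^sub>R e k + x$l *\<^sub>R e l" for x :: "real^4"
  proof -
    have "m = i \<or> m = j \<or> m = k \<or> m = l" for m using U by auto
    then show ?thesis using dist by (subst vec_eq_iff) (force simp: axis_def)
  qed
  have "linear ?J"
    by (rule linearI) (simp_all add: algebra_simps add_divide_distrib)
  moreover have "?J (?J x) = - x" for x
    using st dist by (subst arg_cong[OF ex[of x], of uminus]) (simp add: axis_def algebra_simps)
  moreover have "?J (e i) = s *\<^sub>R e k" "?J (e j) = t *\<^sub>R e l"
    using dist by (simp_all add: axis_def)
  ultimately show ?thesis unfolding J_of_def u
    using J_of_ex1[OF U st] by (intro the1_equality) blast+
qed

section \<open>The listed structures and their symplectic forms\<close>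

lemma UNIV_perm: "{1, 2, 4, 3} = (UNIV::4 set)" "{1, 2, 3, 4} = (UNIV::4 set)"
  "{1, 3, 2, 4} = (UNIV::4 set)" "{4, 2, 1, 3} = (UNIV::4 set)" "{4, 1, 2, 3} = (UNIV::4 set)"
  "{4, 1, 3, 2} = (UNIV::4 set)"
  unfolding UNIV_4 by blast+

text \<open>In these names a pair of digits \<open>ij\<close> stands for a multiple of the \<open>j\<close>-th basis vector as the
  image of the \<open>i\<close>-th one; \<open>m\<close> marks the sign.\<close>

lemma J_12_34: "J_of 1 (e 2) 3 (e 4) = (\<lambda>x. vector [- x$2, x$1, - x$4, x$3])"
  by (subst J_of_eq[of 1 3 2 4 1 1]) (simp_all add: UNIV_perm fun_eq_iff vec_eq_iff forall_4 axis_def)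
lemma J_14_23: "J_of 1 (e 4) 2 (e 3) = (\<lambda>x. vector [- x$4, - x$3, x$2, x$1])"
  by (subst J_of_eq[of 1 2 4 3 1 1]) (simp_all add: UNIV_perm fun_eq_iff vec_eq_iff forall_4 axis_def)
lemma J_13_24: "J_of 1 (e 3) 2 (e 4) = (\<lambda>x. vector [- x$3, - x$4, x$1, x$2])"
  by (subst J_of_eq[of 1 2 3 4 1 1]) (simp_all add: UNIV_perm fun_eq_iff vec_eq_iff forall_4 axis_def)
lemma J_12m_34: "J_of 1 (- e 2) 3 (e 4) = (\<lambda>x. vector [x$2, - x$1, - x$4, x$3])"
  by (subst J_of_eq[of 1 3 2 4 "-1" 1]) (simp_all add: UNIV_perm fun_eq_iff vec_eq_iff forall_4 axis_def)
lemma J_41_23: "J_of 4 (e 1) 2 (e 3) = (\<lambda>x. vector [x$4, - x$3, x$2, - x$1])"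
  by (subst J_of_eq[of 4 2 1 3 1 1]) (simp_all add: UNIV_perm fun_eq_iff vec_eq_iff forall_4 axis_def)
lemma J_41_23m: "J_of 4 (e 1) 2 (- e 3) = (\<lambda>x. vector [x$4, x$3, - x$2, - x$1])"
  by (subst J_of_eq[of 4 2 1 3 1 "-1"]) (simp_all add: UNIV_perm fun_eq_iff vec_eq_iff forall_4 axis_def)
lemma J_42m_13: "J_of 4 (- e 2) 1 (e 3) = (\<lambda>x. vector [- x$3, - x$4, x$1, x$2])"
  by (subst J_of_eq[of 4 1 2 3 "-1" 1]) (simp_all add: UNIV_perm fun_eq_iff vec_eq_iff forall_4 axis_def)
lemma J_41m2_23: "J_of 4 ((-2) *\<^sub>R e 1) 2 (e 3) = (\<lambda>x. vector [- 2 * x$4, - x$3, x$2, x$1 / 2])"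
  by (subst J_of_eq[of 4 2 1 3 "-2" 1]) (simp_all add: UNIV_perm fun_eq_iff vec_eq_iff forall_4 axis_def)
lemma J_43_12: "J_of 4 (e 3) 1 (e 2) = (\<lambda>x. vector [- x$2, x$1, x$4, - x$3])"
  by (subst J_of_eq[of 4 1 3 2 1 1]) (simp_all add: UNIV_perm fun_eq_iff vec_eq_iff forall_4 axis_def)
lemma J_43_12m: "J_of 4 (e 3) 1 (- e 2) = (\<lambda>x. vector [x$2, - x$1, x$4, - x$3])"
  by (subst J_of_eq[of 4 1 3 2 1 "-1"]) (simp_all add: UNIV_perm fun_eq_iff vec_eq_iff forall_4 axis_def)
lemma J_43m_12: "J_of 4 (- e 3) 1 (e 2) = (\<lambda>x. vector [- x$2, x$1, - x$4, x$3])"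
  by (subst J_of_eq[of 4 1 3 2 "-1" 1]) (simp_all add: UNIV_perm fun_eq_iff vec_eq_iff forall_4 axis_def)
lemma J_43m_12m: "J_of 4 (- e 3) 1 (- e 2) = (\<lambda>x. vector [x$2, - x$1, - x$4, x$3])"
  by (subst J_of_eq[of 4 1 3 2 "-1" "-1"]) (simp_all add: UNIV_perm fun_eq_iff vec_eq_iff forall_4 axis_def)

lemmas J_explicit = J_12_34 J_14_23 J_13_24 J_12m_34 J_41_23 J_41_23m J_42m_13 J_41m2_23
  J_43_12 J_43_12m J_43m_12 J_43m_12m

lemmas br_defs = br_rh3_def br_rr_aff_def br_re2_def br_aff_aff_def br_affC_def br_r4_def
  br_r4'_def br_d4_def br_d4'_def

lemma alternating_eqI:
  fixes B C :: "real^4 \<Rightarrow> real^4 \<Rightarrow> 'b::real_vector"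
  assumes B: "bilinear B" "\<And>x. B x x = 0" and C: "bilinear C" "\<And>x. C x x = 0"
    and "B (e 1) (e 2) = C (e 1) (e 2)" "B (e 1) (e 3) = C (e 1) (e 3)"
      "B (e 1) (e 4) = C (e 1) (e 4)" "B (e 2) (e 3) = C (e 2) (e 3)"
      "B (e 2) (e 4) = C (e 2) (e 4)" "B (e 3) (e 4) = C (e 3) (e 4)"
  shows "B x y = C x y"
  by (simp only: alternating_expansion[OF B, of x y] alternating_expansion[OF C, of x y] assms(5-))

text \<open>The value of \<open>d\<omega>\<close> on three vectors, up to sign.\<close>

definition cyc :: "('a \<Rightarrow> 'a \<Rightarrow> 'a) \<Rightarrow> ('a \<Rightarrow> 'a \<Rightarrow> real) \<Rightarrow> 'a \<Rightarrow> 'a \<Rightarrow> 'a \<Rightarrow> real" where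
  "cyc br \<omega> x y z = \<omega> (br x y) z + \<omega> (br y z) x + \<omega> (br z x) y"

lemma cyc_rotate: "cyc br \<omega> x y z = cyc br \<omega> y z x"
  by (simp add: cyc_def)

text \<open>\<open>d\<omega>\<close> is an alternating 3-form, so it is determined by its values on the four increasing
  triples of basis vectors.\<close>

lemma closed_iff_basis:
  fixes br :: "real^4 \<Rightarrow> real^4 \<Rightarrow> real^4"
  assumes br: "bilinear br" "\<And>x. br x x = 0" and \<omega>: "bilinear \<omega>" "\<And>x. \<omega> x x = 0"
  shows "(\<forall>x y z. cyc br \<omega> x y z = 0) \<longleftrightarrow>
    cyc br \<omega> (e 1) (e 2) (e 3) = 0 \<and> cyc br \<omega> (e 1) (e 2) (e 4) = 0 \<and>
    cyc br \<omega> (e 1) (e 3) (e 4) = 0 \<and> cyc br \<omega> (e 2) (e 3) (e 4) = 0"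
    (is "_ \<longleftrightarrow> ?B")
proof
  assume B: ?B
  note lin = bilinear_ladd[OF br(1)] bilinear_radd[OF br(1)] bilinear_lmul[OF br(1)]
      bilinear_rmul[OF br(1)] bilinear_ladd[OF \<omega>(1)] bilinear_radd[OF \<omega>(1)] bilinear_lmul[OF \<omega>(1)]
      bilinear_rmul[OF \<omega>(1)]
  have bil: "bilinear (\<lambda>x y. cyc br \<omega> x y z)" for z
    by (simp add: bilinear_def linear_iff cyc_def lin algebra_simps)
  have alt: "cyc br \<omega> x x z = 0" for x z
    using alternating_swap[OF br, of x z]
    by (simp add: cyc_def br(2) bilinear_lneg[OF \<omega>(1)] bilinear_lzero[OF \<omega>(1)])
  have lin3: "cyc br \<omega> x y z = z$1 * cyc br \<omega> x y (e 1) + z$2 * cyc br \<omega> x y (e 2)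
     + z$3 * cyc br \<omega> x y (e 3) + z$4 * cyc br \<omega> x y (e 4)" for x y z
    by (subst axis_expansion[of z]) (simp only: cyc_def lin real_scaleR_def distrib_left ac_simps)
  have alt2: "cyc br \<omega> x y x = 0" "cyc br \<omega> y x x = 0" for x y
    using alt[of x y] by (metis cyc_rotate)+
  have rev: "cyc br \<omega> z y x = - cyc br \<omega> x y z" for x y z
    using alternating_swap[OF bil alt, of y x z] cyc_rotate[of br \<omega> z y x] by simp
  have odd: "cyc br \<omega> x z y = - cyc br \<omega> x y z" for x y z
    by (rule trans[OF cyc_rotate rev])
  have "cyc br \<omega> x y z = 0" for x y z
    by (rule trans[OF alternating_eqI[OF bil alt, of "\<lambda>_ _. 0"]])
      (use B in \<open>simp_all add: bilinear_def linear_iff lin3[of _ _ z] alt2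
        odd[of "e 1" "e 3" "e 2"] odd[of "e 1" "e 4" "e 2"] odd[of "e 1" "e 4" "e 3"]
        odd[of "e 2" "e 4" "e 3"] cyc_rotate[of br \<omega> "e 1" "e 2" "e 3", symmetric]
        cyc_rotate[of br \<omega> "e 1" "e 2" "e 4", symmetric]
        cyc_rotate[of br \<omega> "e 3" "e 4" "e 1"] cyc_rotate[of br \<omega> "e 3" "e 4" "e 2"]
        cyc_rotate[of br \<omega> "e 4" "e 1" "e 3"] cyc_rotate[of br \<omega> "e 4" "e 2" "e 3"]\<close>)
  then show "\<forall>x y z. cyc br \<omega> x y z = 0" by blast
qed blast

lemma form6_eq_iff:
  "form6 a b c d p q = form6 a' b' c' d' p' q' \<longleftrightarrow>
    a = a' \<and> b = b' \<and> c = c' \<and> d = d' \<and> p = p' \<and> q = q'"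
proof
  have "form6 a b c d p q (e 1) (e 2) = a" "form6 a b c d p q (e 1) (e 3) = b"
    "form6 a b c d p q (e 1) (e 4) = c" "form6 a b c d p q (e 2) (e 3) = d"
    "form6 a b c d p q (e 2) (e 4) = p" "form6 a b c d p q (e 3) (e 4) = q" for a b c d p q
    by (simp_all add: form6_def ew_def axis_def)
  then show "form6 a b c d p q = form6 a' b' c' d' p' q' \<Longrightarrow>
    a = a' \<and> b = b' \<and> c = c' \<and> d = d' \<and> p = p' \<and> q = q'" by metis
qed simp

lemma kaehler_forms:
  assumes "lie_algebra br" and J: "linear J"
  shows "{\<omega>. symplectic_structure br \<omega> \<and> compatible J \<omega>} = {form6 a b c d p q | a b c d p q.
     a * q - b * p + c * d \<noteq> 0 \<and>
     cyc br (form6 a b c d p q) (e 1) (e 2) (e 3) = 0 \<and> cyc br (form6 a b c d p q) (e 1) (e 2) (e 4) = 0 \<and>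
     cyc br (form6 a b c d p q) (e 1) (e 3) (e 4) = 0 \<and> cyc br (form6 a b c d p q) (e 2) (e 3) (e 4) = 0 \<and>
     form6 a b c d p q (J (e 1)) (J (e 2)) = a \<and> form6 a b c d p q (J (e 1)) (J (e 3)) = b \<and>
     form6 a b c d p q (J (e 1)) (J (e 4)) = c \<and> form6 a b c d p q (J (e 2)) (J (e 3)) = d \<and>
     form6 a b c d p q (J (e 2)) (J (e 4)) = p \<and> form6 a b c d p q (J (e 3)) (J (e 4)) = q}"
proof -
  have br: "bilinear br" "\<And>x. br x x = 0" using assms(1) by (auto simp: lie_algebra_def)
  have *: "symplectic_structure br \<omega> \<longleftrightarrow> (\<exists>a b c d p q. \<omega> = form6 a b c d p q \<and>
     a * q - b * p + c * d \<noteq> 0 \<and>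
     cyc br \<omega> (e 1) (e 2) (e 3) = 0 \<and> cyc br \<omega> (e 1) (e 2) (e 4) = 0 \<and>
     cyc br \<omega> (e 1) (e 3) (e 4) = 0 \<and> cyc br \<omega> (e 2) (e 3) (e 4) = 0)" for \<omega>
  proof (cases "bilinear \<omega> \<and> (\<forall>x. \<omega> x x = 0)")
    case True
    then obtain a b c d p q where \<omega>: "\<omega> = form6 a b c d p q"
      using alternating_form6 by blast
    show ?thesis
      unfolding symplectic_structure_def cyc_def[symmetric] \<omega> form6_nondegenerate
        closed_iff_basis[OF br bilinear_form6 form6_alt]
      by (auto simp: bilinear_form6 form6_alt form6_eq_iff)
  next
    case False
    then show ?thesis
      using bilinear_form6 form6_alt by (auto simp: symplectic_structure_def)
  qed
  have "compatible J (form6 a b c d p q) \<longleftrightarrow>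
     form6 a b c d p q (J (e 1)) (J (e 2)) = a \<and> form6 a b c d p q (J (e 1)) (J (e 3)) = b \<and>
     form6 a b c d p q (J (e 1)) (J (e 4)) = c \<and> form6 a b c d p q (J (e 2)) (J (e 3)) = d \<and>
     form6 a b c d p q (J (e 2)) (J (e 4)) = p \<and> form6 a b c d p q (J (e 3)) (J (e 4)) = q"
    for a b c d p q
  proof -
    have "bilinear (\<lambda>x y. form6 a b c d p q (J x) (J y))"
      using J by (auto simp: bilinear_def linear_iff form6_def ew_def algebra_simps)
    note * = alternating_form6[OF this form6_alt]
    have "compatible J (form6 a b c d p q) \<longleftrightarrow>
        (\<lambda>x y. form6 a b c d p q (J x) (J y)) = form6 a b c d p q"
      by (simp add: compatible_def fun_eq_iff)
    then show ?thesis by (subst (asm) *) (simp only: form6_eq_iff)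
  qed
  then show ?thesis unfolding * by blast
qed

lemma lie_models:
  "lie_algebra br_rh3" "lie_algebra br_rr_aff" "lie_algebra br_re2" "lie_algebra br_aff_aff"
  "lie_algebra br_affC" "lie_algebra br_r4" "lie_algebra (br_r4' \<delta>)" "lie_algebra (br_d4 l)"
  "lie_algebra (br_d4' \<delta>)"
  by (simp_all add: lie_algebra_def bilinear_def linear_iff br_defs ew_def vec_eq_iff forall_4
      axis_def algebra_simps add_divide_distrib)

lemma model_complex: "kaehler_model br J \<Omega> \<Longrightarrow> complex_structure br J"
  by (induction rule: kaehler_model.induct)
    (simp_all only: J_explicit, simp_all add: complex_structure_def linear_iff br_defs ew_def
      vec_eq_iff forall_4 axis_def field_simps)

lemma listed_forms:
  "(\<lambda>x y. a * (ew 1 3 x y + ew 2 4 x y) + b * (ew 1 4 x y - ew 2 3 x y) + c * ew 1 2 x y)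
    = form6 c a b (- b) a 0"
  "(\<lambda>x y. a * ew 1 2 x y + b * ew 3 4 x y) = form6 a 0 0 0 0 b"
  "(\<lambda>x y. a * ew 1 4 x y + b * ew 2 3 x y) = form6 0 0 a b 0 0"
  "(\<lambda>x y. a * (ew 1 3 x y - ew 2 4 x y) + b * (ew 1 4 x y + ew 2 3 x y)) = form6 0 a b b (- a) 0"
  "(\<lambda>x y. a * (ew 1 3 x y - ew 2 4 x y) + b * (ew 1 4 x y + ew 2 3 x y) + c * ew 1 2 x y)
    = form6 c a b b (- a) 0"
  "(\<lambda>x y. a * (ew 1 2 x y + ew 3 4 x y) + b * (ew 1 3 x y - ew 2 4 x y) + c * ew 1 4 x y)
    = form6 a b c 0 (- b) a"
  "(\<lambda>x y. a * (ew 1 2 x y - ew 3 4 x y) + b * ew 1 4 x y) = form6 a 0 b 0 0 (- a)"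
  "(\<lambda>x y. a * (ew 1 4 x y + ew 2 3 x y) + b * ew 2 4 x y) = form6 0 0 a a b 0"
  "(\<lambda>x y. a * (ew 1 2 x y - ew 3 4 x y)) = form6 a 0 0 0 0 (- a)"
  "(\<lambda>x y. a * (ew 1 2 x y - \<delta> * ew 3 4 x y)) = form6 a 0 0 0 0 (- a * \<delta>)"
  by (simp_all add: fun_eq_iff form6_def algebra_simps)

lemma neg_square_eq: "- (x * x) = y * y \<longleftrightarrow> x = 0 \<and> y = 0" "y * y = - (x * x) \<longleftrightarrow> x = 0 \<and> y = 0" for x y :: real
  using sum_squares_eq_zero_iff[of x y] by linarith+

text \<open>The closedness equations of the two twisted families couple pairs of coefficients by a
  rotation. The next three lemmas express that a rotation has no real eigenvalues, so these
  coefficients vanish.\<close>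

lemma times_square_plus_self_eq_0_iff: "b * \<delta> * \<delta> + b = 0 \<longleftrightarrow> b = 0" for b \<delta> :: real
proof -
  have "b * \<delta> * \<delta> + b = b * (\<delta> * \<delta> + 1)" by (simp add: algebra_simps)
  moreover have "\<delta> * \<delta> + 1 \<noteq> 0" using zero_le_square[of \<delta>] by linarith
  ultimately show ?thesis by simp
qed

lemma twisted_system_trivial: "3 * (\<delta> * b) = c * 2 \<Longrightarrow> 3 * (\<delta> * c) / 2 + b = 0 \<Longrightarrow> b = 0 \<and> c = 0" for b c \<delta> :: real
proof -
  assume *: "3 * (\<delta> * b) = c * 2" "3 * (\<delta> * c) / 2 + b = 0"
  have "b * (3/2 * \<delta>) * (3/2 * \<delta>) + b = 0" using * by algebra
  then show ?thesis using * by (simp only: times_square_plus_self_eq_0_iff) simp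
qed

lemma twisted_system_trivial': "3 * (\<delta> * b) = - (c * 2) \<Longrightarrow> b * 2 = 3 * (\<delta> * c) \<Longrightarrow> b = 0 \<and> c = 0" for b c \<delta> :: real
  using twisted_system_trivial[of \<delta> b "- c"] by simp

lemma eq_minus_times_if_sum_0: "\<delta> * a + q = 0 \<Longrightarrow> q = - (a * \<delta>)" for a q \<delta> :: real
  by (simp add: algebra_simps add_eq_0_iff)

lemma model_forms:
  "kaehler_model br J \<Omega> \<Longrightarrow> linear J \<Longrightarrow>
    {\<omega>. symplectic_structure br \<omega> \<and> compatible J \<omega>} = \<Omega>"
  by (induction rule: kaehler_model.induct; (rule trans[OF kaehler_forms], rule lie_models,
      assumption, simp only: listed_forms J_explicit,
      auto simp: form6_eq_iff cyc_def br_defs form6_def ew_def axis_def neg_square_eq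
        times_square_plus_self_eq_0_iff
      dest!: twisted_system_trivial twisted_system_trivial' eq_minus_times_if_sum_0))

section \<open>A unimodular ideal of codimension one\<close>

definition ad_trace :: "(real^4 \<Rightarrow> real^4 \<Rightarrow> real^4) \<Rightarrow> real^4 \<Rightarrow> real" where
  "ad_trace br x = trace (matrix (br x))"

lemma ad_trace_eq:
  "ad_trace br x = br x (e 1) $ 1 + br x (e 2) $ 2 + br x (e 3) $ 3 + br x (e 4) $ 4"
  by (simp add: ad_trace_def trace_def matrix_def sum_4)

lemma ad_trace_bracket:
  assumes "lie_algebra br" shows "ad_trace br (br x y) = 0"
proof -
  have bil: "bilinear br" and alt: "\<And>x. br x x = 0"
    and jac: "\<And>x y z. br x (br y z) + br y (br z x) + br z (br x y) = 0"
    using assms by (auto simp: lie_algebra_def)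
  have lin: "linear (br x)" for x using bil by (simp add: bilinear_def)
  have "br (br x y) z = br x (br y z) - br y (br x z)" for z
  proof -
    have "br z (br x y) = - br (br x y) z" by (rule alternating_swap[OF bil alt])
    moreover have "br y (br z x) = - br y (br x z)"
      by (simp add: alternating_swap[OF bil alt, of z x] bilinear_rneg[OF bil])
    ultimately have "br x (br y z) - br y (br x z) - br (br x y) z = 0"
      using jac[of x y z] by simp
    then show ?thesis by simp
  qed
  then have "ad_trace br (br x y) = trace (matrix (br x \<circ> br y)) - trace (matrix (br y \<circ> br x))"
    by (simp add: ad_trace_def trace_def matrix_def sum_4)
  also have "\<dots> = 0"
    by (simp only: matrix_compose[OF lin lin] trace_mul_sym[of "matrix (br x)"] diff_self)
  finally show ?thesis .
qed

lemma ad_trace_conj: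
  assumes "lie_algebra br" "linear P" "linear Q" "\<And>x. P (Q x) = x"
  shows "ad_trace (\<lambda>x y. Q (br (P x) (P y))) x = ad_trace br (P x)"
proof -
  have lin: "linear (br x)" for x using assms by (simp add: bilinear_def lie_algebra_def)
  have "ad_trace (\<lambda>x y. Q (br (P x) (P y))) x = trace (matrix (Q \<circ> (br (P x) \<circ> P)))"
    by (simp add: ad_trace_def o_def)
  also have "\<dots> = trace (matrix ((br (P x) \<circ> P) \<circ> Q))"
    by (simp only: matrix_compose[OF linear_compose[OF \<open>linear P\<close> lin] \<open>linear Q\<close>]
        matrix_compose[OF \<open>linear Q\<close> linear_compose[OF \<open>linear P\<close> lin]] trace_mul_sym[of "matrix Q"])
  also have "(br (P x) \<circ> P) \<circ> Q = br (P x)" using assms(4) by (simp add: fun_eq_iff)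
  finally show ?thesis by (simp add: ad_trace_def)
qed

text \<open>The identity \<open>d\<alpha> \<and> d\<alpha> = d(\<alpha> \<and> d\<alpha>)\<close>, together with the fact that the differential of a 3-form
  is, up to sign, its wedge product with \<open>tr ad\<close>.\<close>

lemma wedge_square_zero:
  fixes \<alpha> :: "real^4"
  assumes "lie_algebra br" and T: "\<And>x. ad_trace br x = 0"
  defines "a \<equiv> \<lambda>i j. \<alpha> \<bullet> br (e i) (e j)"
  shows "a 1 2 * a 3 4 - a 1 3 * a 2 4 + a 1 4 * a 2 3 = 0"
proof -
  have bil: "bilinear br" and alt: "\<And>x. br x x = 0"
    and jac: "\<And>x y z. br x (br y z) + br y (br z x) + br z (br x y) = 0"
    using assms by (auto simp: lie_algebra_def)
  note sw = alternating_swap[OF bil alt]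
  define c where "c i j k = br (e i) (e j) $ k" for i j k
  have c0: "c i i k = 0" for i k by (simp add: c_def alt)
  have csw: "c j i k = - c i j k" for i j k using sw[of "e i" "e j"] by (simp add: c_def)
  have a: "a i j = \<alpha>$1 * c i j 1 + \<alpha>$2 * c i j 2 + \<alpha>$3 * c i j 3 + \<alpha>$4 * c i j 4" for i j
    by (simp add: a_def inner_vec_def sum_4 c_def)
  have ab: "\<alpha> \<bullet> br (e i) x = x$1 * a i 1 + x$2 * a i 2 + x$3 * a i 3 + x$4 * a i 4" for i x
    by (subst axis_expansion[of x])
      (simp add: bilinear_radd[OF bil] bilinear_rmul[OF bil] a_def inner_add_right)
  define jacobi where "jacobi i j k =
     c j k 1 * a i 1 + c j k 2 * a i 2 + c j k 3 * a i 3 + c j k 4 * a i 4 +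
     c k i 1 * a j 1 + c k i 2 * a j 2 + c k i 3 * a j 3 + c k i 4 * a j 4 +
     c i j 1 * a k 1 + c i j 2 * a k 2 + c i j 3 * a k 3 + c i j 4 * a k 4" for i j k
  have J: "jacobi i j k = 0" for i j k
    using arg_cong[OF jac[of "e i" "e j" "e k"], of "\<lambda>v. \<alpha> \<bullet> v"]
    by (simp add: inner_add_right ab jacobi_def c_def)
  define t where "t i = c i 1 1 + c i 2 2 + c i 3 3 + c i 4 4" for i
  have t: "t i = 0" for i using T[of "e i"] by (simp add: t_def ad_trace_eq c_def)
  define \<theta> where "\<theta> j k l = \<alpha>$j * a k l - \<alpha>$k * a j l + \<alpha>$l * a j k" for j k l
  \<comment> \<open>\<open>\<theta>\<close> is \<open>\<alpha> \<and> d\<alpha>\<close>. The Jacobi terms make up \<open>\<alpha> \<and> dd\<alpha>\<close>, the trace terms \<open>d\<theta>\<close>.\<close>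
  have "2 * (a 1 2 * a 3 4 - a 1 3 * a 2 4 + a 1 4 * a 2 3) =
     \<alpha>$4 * jacobi 1 2 3 - \<alpha>$3 * jacobi 1 2 4 + \<alpha>$2 * jacobi 1 3 4 - \<alpha>$1 * jacobi 2 3 4
     + t 1 * \<theta> 2 3 4 - t 2 * \<theta> 1 3 4 + t 3 * \<theta> 1 2 4 - t 4 * \<theta> 1 2 3"
    unfolding jacobi_def t_def \<theta>_def a c0 csw[of 2 1] csw[of 3 1] csw[of 4 1] csw[of 3 2] csw[of 4 2]
      csw[of 4 3] by (simp add: algebra_simps)
  then show ?thesis by (simp add: J t)
qed

lemma exists_common_orthogonal:
  fixes a b c :: "real^4" shows "\<exists>x. x \<noteq> 0 \<and> x \<bullet> a = 0 \<and> x \<bullet> b = 0 \<and> x \<bullet> c = 0"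
proof -
  have "dim {a, b, c} \<le> card {a, b, c}" by (rule dim_le_card') simp
  also have "\<dots> \<le> 3" by (simp add: card_insert_if)
  finally have "dim {a, b, c} < DIM(real^4)" by simp
  then show ?thesis
    using orthogonal_to_subspace_exists[of "{a, b, c}"]
    by (metis insertCI orthogonal_def span_base)
qed

text \<open>In the unimodular case the isotropy of the image of \<open>d\<close> is used on a 1-form whose
  differential is self-dual in the standard basis; such a 1-form exists because self-duality
  is three linear conditions on four unknowns. The wedge product is definite on self-dual
  forms, so the differential vanishes.\<close>

lemma unimodular_ideal_exists:
  assumes lie: "lie_algebra br"
  shows "\<exists>\<tau>. \<tau> \<noteq> 0 \<and> (\<forall>x y. \<tau> \<bullet> br x y = 0) \<and> (\<forall>x. \<tau> \<bullet> x = 0 \<longrightarrow> ad_trace br x = 0)"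
proof -
  have bil: "bilinear br" and alt: "\<And>x. br x x = 0" using lie by (auto simp: lie_algebra_def)
  show ?thesis
  proof (cases "\<forall>x. ad_trace br x = 0")
    case False
    define \<tau> :: "real^4" where "\<tau> = (\<chi> i. ad_trace br (e i))"
    have T: "ad_trace br x = \<tau> \<bullet> x" for x
    proof -
      have "ad_trace br x = ad_trace br (x$1 *\<^sub>R e 1 + x$2 *\<^sub>R e 2 + x$3 *\<^sub>R e 3 + x$4 *\<^sub>R e 4)"
        using axis_expansion[of x] by simp
      also have "\<dots> = \<tau> \<bullet> x"
        unfolding ad_trace_eq
        by (simp add: bilinear_ladd[OF bil] bilinear_lmul[OF bil] \<tau>_def inner_vec_def sum_4
            ad_trace_eq algebra_simps)
      finally show ?thesis .
    qed
    with False have "\<tau> \<noteq> 0" by auto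
    then show ?thesis using T ad_trace_bracket[OF lie] by metis
  next
    case True
    define b where "b i j = br (e i) (e j)" for i j
    obtain \<tau> where \<tau>: "\<tau> \<noteq> 0" "\<tau> \<bullet> (b 1 2 - b 3 4) = 0" "\<tau> \<bullet> (b 1 3 + b 2 4) = 0" "\<tau> \<bullet> (b 1 4 - b 2 3) = 0"
      using exists_common_orthogonal by blast
    have "(\<tau> \<bullet> b 1 2) * (\<tau> \<bullet> b 3 4) - (\<tau> \<bullet> b 1 3) * (\<tau> \<bullet> b 2 4) + (\<tau> \<bullet> b 1 4) * (\<tau> \<bullet> b 2 3) = 0"
      using wedge_square_zero[OF lie, of \<tau>] True by (simp add: b_def)
    moreover have eqs: "\<tau> \<bullet> b 3 4 = \<tau> \<bullet> b 1 2" "\<tau> \<bullet> b 2 4 = - (\<tau> \<bullet> b 1 3)" "\<tau> \<bullet> b 2 3 = \<tau> \<bullet> b 1 4"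
      using \<tau> by (simp_all add: inner_diff_right inner_add_right)
    ultimately have "(\<tau> \<bullet> b 1 2)\<^sup>2 + (\<tau> \<bullet> b 1 3)\<^sup>2 + (\<tau> \<bullet> b 1 4)\<^sup>2 = 0"
      by (simp add: power2_eq_square)
    then have "\<tau> \<bullet> b 1 2 = 0" "\<tau> \<bullet> b 1 3 = 0" "\<tau> \<bullet> b 1 4 = 0"
      by (smt (verit) zero_le_power2 power2_less_eq_zero_iff)+
    then have "\<tau> \<bullet> br x y = 0" for x y
      using eqs by (subst alternating_expansion[OF bil alt]) (simp add: inner_add_right b_def)
    then show ?thesis using \<tau>(1) True by blast
  qed
qed

section \<open>Frames adapted to the ideal\<close>

text \<open>The vectors \<open>w\<close> and \<open>J w\<close> span the complex line in the kernel of \<open>\<tau>\<close>, \<open>z\<close> completes them to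
  a basis of this kernel, and \<open>J z\<close> is transversal to it.\<close>

definition adapted_frame :: "(real^4 \<Rightarrow> real^4) \<Rightarrow> real^4 \<Rightarrow> real^4 \<Rightarrow> real^4 \<Rightarrow> bool" where
  "adapted_frame J \<tau> w z \<longleftrightarrow>
     w \<noteq> 0 \<and> \<tau> \<bullet> w = 0 \<and> \<tau> \<bullet> J w = 0 \<and> \<tau> \<bullet> z = 0 \<and> \<tau> \<bullet> J z \<noteq> 0"

definition frame_map :: "(real^4 \<Rightarrow> real^4) \<Rightarrow> real^4 \<Rightarrow> real^4 \<Rightarrow> real^4 \<Rightarrow> real^4" where
  "frame_map J w z x = x$1 *\<^sub>R w + x$2 *\<^sub>R J w + x$3 *\<^sub>R z + x$4 *\<^sub>R J z"

lemma linear_frame_map: "linear (frame_map J w z)"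
  by (simp add: linear_iff frame_map_def algebra_simps)

context
  fixes J :: "real^4 \<Rightarrow> real^4"
  assumes J: "linear J" and JJ: "\<And>x. J (J x) = - x"
begin

lemmas J_simps = linear_add[OF J] linear_diff[OF J] linear_cmul[OF J] linear_neg[OF J] linear_0[OF J] JJ

lemma adapted_frame_exists:
  assumes "\<tau> \<noteq> 0" shows "\<exists>w z. adapted_frame J \<tau> w z"
proof -
  obtain w where w: "w \<noteq> 0" "w \<bullet> \<tau> = 0" "w \<bullet> adjoint J \<tau> = 0"
    using exists_common_orthogonal[of \<tau> "adjoint J \<tau>" 0] by blast
  have "\<tau> \<bullet> J w = 0" using w(3) adjoint_works[OF J, of w \<tau>] by (simp add: inner_commute)
  \<comment> \<open>The combination of \<open>\<tau>\<close> and \<open>J \<tau>\<close> on which the functional \<open>\<tau>\<close> vanishes.\<close>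
  moreover define z where "z = (\<tau> \<bullet> J \<tau>) *\<^sub>R \<tau> - (\<tau> \<bullet> \<tau>) *\<^sub>R J \<tau>"
  have "\<tau> \<bullet> z = 0" by (simp add: z_def inner_diff_right)
  moreover have "\<tau> \<bullet> J z = (\<tau> \<bullet> J \<tau>)\<^sup>2 + (\<tau> \<bullet> \<tau>)\<^sup>2"
    by (simp add: z_def J_simps inner_add_right inner_diff_right power2_eq_square)
  moreover have "(\<tau> \<bullet> \<tau>)\<^sup>2 > 0" using assms by simp
  ultimately show ?thesis using w unfolding adapted_frame_def
    by (metis add_nonneg_pos inner_commute less_irrefl zero_le_power2)
qed

lemma frame_map_inj:
  assumes "adapted_frame J \<tau> w z" shows "inj (frame_map J w z)"
proof (rule linear_injective_0[THEN iffD2, OF linear_frame_map], intro allI impI)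
  note A = assms[unfolded adapted_frame_def]
  fix x assume x: "frame_map J w z x = 0"
  have "\<tau> \<bullet> frame_map J w z x = x$4 * (\<tau> \<bullet> J z)"
    using A by (simp add: frame_map_def inner_add_right)
  then have x4: "x$4 = 0" using x A by simp
  have "J (frame_map J w z x) = x$1 *\<^sub>R J w - x$2 *\<^sub>R w + x$3 *\<^sub>R J z - x$4 *\<^sub>R z"
    by (simp add: frame_map_def J_simps)
  then have "\<tau> \<bullet> J (frame_map J w z x) = x$3 * (\<tau> \<bullet> J z)"
    using A by (simp add: inner_add_right inner_diff_right)
  then have x3: "x$3 = 0" using x A by (simp add: J_simps)
  have w: "x$1 *\<^sub>R w + x$2 *\<^sub>R J w = 0" using x x3 x4 by (simp add: frame_map_def)
  moreover have "J (x$1 *\<^sub>R w + x$2 *\<^sub>R J w) = x$1 *\<^sub>R J w - x$2 *\<^sub>R w" by (simp add: J_simps)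
  ultimately have "x$1 *\<^sub>R J w - x$2 *\<^sub>R w = 0" by (simp only: linear_0[OF J])
  then have "x$1 *\<^sub>R (x$1 *\<^sub>R w + x$2 *\<^sub>R J w) - x$2 *\<^sub>R (x$1 *\<^sub>R J w - x$2 *\<^sub>R w) = 0" using w by simp
  then have "((x$1)\<^sup>2 + (x$2)\<^sup>2) *\<^sub>R w = 0" by (simp add: algebra_simps power2_eq_square)
  then have "(x$1)\<^sup>2 + (x$2)\<^sup>2 = 0" using A by simp
  then show "x = 0" using x3 x4 by (simp add: vec_eq_iff forall_4)
qed

lemma frame_map_surj:
  assumes "adapted_frame J \<tau> w z" shows "surj (frame_map J w z)"
  by (rule linear_inj_imp_surj[OF linear_frame_map frame_map_inj[OF assms]])

lemma adapted_frame_ideal: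
  assumes "adapted_frame J \<tau> w z" "\<tau> \<bullet> y = 0"
  shows "\<exists>a b c. y = a *\<^sub>R w + b *\<^sub>R J w + c *\<^sub>R z"
proof -
  obtain x where x: "y = frame_map J w z x" using frame_map_surj[OF assms(1)] by (metis surjD)
  have "x$4 = 0" using assms unfolding x by (auto simp: frame_map_def inner_add_right adapted_frame_def)
  then show ?thesis using x by (auto simp: frame_map_def)
qed

context
  fixes \<omega> :: "real^4 \<Rightarrow> real^4 \<Rightarrow> real" and br :: "real^4 \<Rightarrow> real^4 \<Rightarrow> real^4" and \<tau> :: "real^4"
  assumes altbr: "\<And>x. br x x = 0" and bil: "bilinear \<omega>" and alt: "\<And>x. \<omega> x x = 0"
    and nondeg: "\<And>x. x \<noteq> 0 \<Longrightarrow> \<exists>y. \<omega> x y \<noteq> 0"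
    and herm: "\<And>x y. \<omega> (J x) (J y) = \<omega> x y"
    and bbr: "bilinear br" and closed: "\<And>x y z. \<omega> (br x y) z + \<omega> (br y z) x + \<omega> (br z x) y = 0"
    and \<tau>0: "\<tau> \<noteq> 0" and \<tau>br: "\<And>x y. \<tau> \<bullet> br x y = 0"
begin

lemmas form_simps = bilinear_ladd[OF bil] bilinear_radd[OF bil] bilinear_lmul[OF bil]
      bilinear_rmul[OF bil] bilinear_lneg[OF bil] bilinear_rneg[OF bil]
      bilinear_lsub[OF bil] bilinear_rsub[OF bil] bilinear_lzero[OF bil] bilinear_rzero[OF bil]
lemmas bracket_simps = bilinear_ladd[OF bbr] bilinear_radd[OF bbr] bilinear_lmul[OF bbr]
      bilinear_rmul[OF bbr] bilinear_lneg[OF bbr] bilinear_rneg[OF bbr]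

lemma form_swap: "\<omega> y x = - \<omega> x y" by (rule alternating_swap[OF bil alt])
lemma hermJ: "\<omega> (J x) y = - \<omega> x (J y)" using herm[of x "J y"] by (simp add: JJ form_simps)

text \<open>If \<open>W\<close> is nondegenerate, orthogonal projection makes \<open>z\<close> orthogonal to it. Then \<open>w\<close> may be
  replaced by any nonzero vector of \<open>W\<close>. The quadratic form \<open>Q x = \<omega> [z, x] (J x)\<close> on \<open>W\<close>
  satisfies \<open>Q (J x) = - Q x\<close>, because \<open>ad z\<close> is traceless on \<open>W\<close>; so it has a nonzero null
  vector \<open>x\<close>. The vector \<open>J x\<close> is null as well, and the last inequality holds for one of the
  two.\<close>

lemma orthogonal_frame_exists:
  assumes A: "adapted_frame J \<tau> w z" and k: "\<omega> w (J w) \<noteq> 0"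
  shows "\<exists>w z. adapted_frame J \<tau> w z \<and> \<omega> w (J w) \<noteq> 0 \<and> \<omega> z w = 0 \<and> \<omega> z (J w) = 0 \<and>
     \<omega> (br z w) (J w) = 0 \<and> (\<omega> w (br z w))\<^sup>2 \<le> (\<omega> (J w) (br z (J w)))\<^sup>2"
proof -
  define z1 where "z1 = z - (\<omega> z (J w) / \<omega> w (J w)) *\<^sub>R w + (\<omega> z w / \<omega> w (J w)) *\<^sub>R J w"
  have z1: "adapted_frame J \<tau> w z1"
    using A by (simp add: adapted_frame_def z1_def J_simps inner_add_right inner_diff_right)
  have zw: "\<omega> z1 w = 0" and zJw: "\<omega> z1 (J w) = 0"
    using k form_swap[of "J w" w] by (simp_all add: z1_def form_simps alt)
  have ideal: "\<omega> y z1 = 0" if "\<tau> \<bullet> y = 0" for y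
    using adapted_frame_ideal[OF z1 that] zw zJw form_swap[of w z1] form_swap[of "J w" z1]
    by (auto simp: form_simps alt)
  define Q where "Q x = \<omega> (br z1 x) (J x)" for x
  have QJ: "Q (J x) = - Q x" for x
    using closed[of z1 x "J x"] ideal[OF \<tau>br] alternating_swap[OF bbr altbr, of z1 "J x"]
    by (simp add: Q_def form_simps JJ)
  have "\<exists>a b. (a\<^sup>2 + b\<^sup>2 \<noteq> (0::real)) \<and> Q (a *\<^sub>R w + b *\<^sub>R J w) = 0"
  proof (cases "Q w = 0")
    case True
    then show ?thesis by (intro exI[of _ 1] exI[of _ 0]) simp
  next
    case False
    define M where "M = \<omega> (br z1 (J w)) (J w) - \<omega> (br z1 w) w"
    have Q: "Q (a *\<^sub>R w + b *\<^sub>R J w) = a\<^sup>2 * Q w + a * b * M - b\<^sup>2 * Q w" for a b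
    proof -
      have "Q (a *\<^sub>R w + b *\<^sub>R J w) = a\<^sup>2 * Q w + a * b * M + b\<^sup>2 * Q (J w)"
        by (simp add: Q_def M_def J_simps form_simps bracket_simps algebra_simps power2_eq_square)
      then show ?thesis by (simp add: QJ)
    qed
    \<comment> \<open>A root of the quadratic equation \<open>Q (a w + 2 (Q w) J w) = 0\<close>; its discriminant is a sum of squares.\<close>
    define a where "a = sqrt (M\<^sup>2 + 4 * (Q w)\<^sup>2) - M"
    have "(a + M)\<^sup>2 = M\<^sup>2 + 4 * (Q w)\<^sup>2" by (simp add: a_def)
    then have "a\<^sup>2 + 2 * a * M = 4 * (Q w)\<^sup>2" by (simp add: power2_eq_square algebra_simps)
    then have "Q (a *\<^sub>R w + (2 * Q w) *\<^sub>R J w) = 0"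
      unfolding Q by algebra
    moreover have "a\<^sup>2 + (2 * Q w)\<^sup>2 \<noteq> 0" using False by (simp only: sum_power2_eq_zero_iff) simp
    ultimately show ?thesis by blast
  qed
  then obtain a b where ab: "a\<^sup>2 + b\<^sup>2 \<noteq> (0::real)" "Q (a *\<^sub>R w + b *\<^sub>R J w) = 0" by blast
  define x where "x = a *\<^sub>R w + b *\<^sub>R J w"
  have Jx: "J x = a *\<^sub>R J w - b *\<^sub>R w" by (simp add: x_def J_simps)
  have kx: "\<omega> x (J x) = (a\<^sup>2 + b\<^sup>2) * \<omega> w (J w)"
    unfolding Jx using form_swap[of "J w" w] by (simp add: x_def form_simps alt power2_eq_square algebra_simps)
  then have kx: "\<omega> x (J x) \<noteq> 0" using ab k by simp
  then have x0: "x \<noteq> 0" by (auto simp: form_simps)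
  have good: "adapted_frame J \<tau> y z1 \<and> \<omega> y (J y) \<noteq> 0 \<and> \<omega> z1 y = 0 \<and> \<omega> z1 (J y) = 0 \<and>
     \<omega> (br z1 y) (J y) = 0" if "y = x \<or> y = J x" for y
  proof -
    have "J x \<noteq> 0" using x0 JJ[of x] linear_0[OF J] by auto
    moreover have "\<tau> \<bullet> x = 0" "\<omega> z1 x = 0"
      using z1 zw zJw by (simp_all add: x_def adapted_frame_def inner_add_right form_simps)
    moreover have "\<tau> \<bullet> J x = 0" "\<omega> z1 (J x) = 0"
      using z1 zw zJw by (simp_all add: Jx adapted_frame_def inner_diff_right form_simps)
    moreover have "\<omega> (br z1 x) (J x) = 0" "\<omega> (br z1 (J x)) (- x) = 0"
      using ab(2) QJ[of x] unfolding x_def[symmetric] by (simp_all add: Q_def JJ)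
    ultimately show ?thesis
      using that z1 kx x0 form_swap[of x "J x"] by (auto simp: adapted_frame_def JJ form_simps)
  qed
  define f where "f y = (\<omega> y (br z1 y))\<^sup>2" for y
  have fJJ: "f (J (J y)) = f y" for y by (simp add: f_def JJ form_simps bracket_simps)
  have "f x \<le> f (J x) \<or> f (J x) \<le> f (J (J x))" unfolding fJJ by linarith
  then show ?thesis using good unfolding f_def by blast
qed

text \<open>If \<open>W\<close> is isotropic, \<open>\<omega>\<close> pairs it with the span of \<open>z\<close> and \<open>J z\<close>. This fixes \<open>w\<close> up to the
  choice of \<open>z\<close>. Adding a multiple of \<open>J w\<close> to \<open>z\<close> makes \<open>\<omega> z (J z)\<close> vanish, and adding a
  multiple of \<open>w\<close> changes none of the values of \<open>\<omega>\<close> on the frame; it is used to simplify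
  \<open>[w, J w]\<close>.\<close>

lemma isotropic_frame_exists:
  assumes A: "adapted_frame J \<tau> w z" and k: "\<omega> w (J w) = 0"
  shows "\<exists>w z. adapted_frame J \<tau> w z \<and> \<omega> w (J w) = 0 \<and> \<omega> z w = 1 \<and> \<omega> z (J w) = 0 \<and> \<omega> z (J z) = 0 \<and>
     (\<omega> (br w (J w)) w \<noteq> 0 \<longrightarrow> \<omega> (br w (J w)) z = 0)"
proof -
  define g h where "g = \<omega> z w" and "h = \<omega> z (J w)"
  have gh: "g\<^sup>2 + h\<^sup>2 \<noteq> 0"
  proof
    assume "g\<^sup>2 + h\<^sup>2 = 0"
    then have 0: "\<omega> z w = 0" "\<omega> z (J w) = 0" by (simp_all add: g_def h_def sum_power2_eq_zero_iff)
    have "\<omega> w y = 0" for y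
    proof -
      obtain x where y: "y = frame_map J w z x" using frame_map_surj[OF A] by (metis surjD)
      have "\<omega> w z = 0" "\<omega> w (J z) = 0" using 0 form_swap[of w z] hermJ[of w z] form_swap[of "J w" z] by auto
      then show ?thesis by (simp add: y frame_map_def form_simps alt k)
    qed
    then show False using nondeg[of w] A by (auto simp: adapted_frame_def)
  qed
  define x where "x = (1 / (g\<^sup>2 + h\<^sup>2)) *\<^sub>R (g *\<^sub>R w + h *\<^sub>R J w)"
  have Jx: "J x = (1 / (g\<^sup>2 + h\<^sup>2)) *\<^sub>R (g *\<^sub>R J w - h *\<^sub>R w)" by (simp add: x_def J_simps)
  have zx: "\<omega> z x = 1"
    using gh by (simp add: x_def form_simps g_def[symmetric] h_def[symmetric] power2_eq_square)
  have zJx: "\<omega> z (J x) = 0"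
    by (simp add: Jx form_simps g_def[symmetric] h_def[symmetric])
  have kx: "\<omega> x (J x) = 0"
    unfolding Jx using form_swap[of "J w" w] by (simp add: x_def form_simps alt k)
  have x: "adapted_frame J \<tau> x z"
    using A zx by (auto simp: adapted_frame_def Jx form_simps inner_diff_right)
     (auto simp: x_def inner_add_right)
  define z1 where "z1 = z + (\<omega> z (J z) / 2) *\<^sub>R J x"
  have xz: "\<omega> x z = -1" "\<omega> (J x) z = 0" "\<omega> (J x) x = 0" "\<omega> x (J z) = 0" "\<omega> (J x) (J z) = -1"
    using zx zJx kx form_swap[of x z] form_swap[of "J x" z] form_swap[of "J x" x] hermJ[of x z] herm[of x z] by auto
  have z1: "\<omega> z1 x = 1" "\<omega> z1 (J x) = 0" "\<omega> z1 (J z1) = 0"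
    using zx zJx xz kx by (simp_all add: z1_def form_simps J_simps alt)
  \<comment> \<open>If the denominator vanishes, then \<open>c = 0\<close> and nothing is to be shown.\<close>
  define c where "c = - \<omega> (br x (J x)) z1 / \<omega> (br x (J x)) x"
  define z2 where "z2 = z1 + c *\<^sub>R x"
  have xz1: "\<omega> x z1 = -1" "\<omega> (J x) z1 = 0" "\<omega> x (J z1) = 0"
    using z1 form_swap[of x z1] form_swap[of "J x" z1] hermJ[of x z1] by auto
  have "adapted_frame J \<tau> x z2"
    using x by (auto simp: adapted_frame_def z1_def z2_def J_simps inner_add_right inner_diff_right)
  moreover have "\<omega> z2 x = 1" "\<omega> z2 (J x) = 0" "\<omega> z2 (J z2) = 0"
    using z1 xz1 kx by (simp_all add: z2_def form_simps J_simps alt)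
  moreover have "\<omega> (br x (J x)) x \<noteq> 0 \<longrightarrow> \<omega> (br x (J x)) z2 = 0"
    by (simp add: z2_def form_simps c_def)
  ultimately show ?thesis using kx by blast
qed

end

end

lemma linear_inv_bij:
  fixes P :: "'b::real_vector \<Rightarrow> 'a::real_vector"
  assumes P: "linear P" "bij P" shows "linear (inv P)"
proof (rule linearI)
  have PQ: "P (inv P x) = x" for x using P by (simp add: bij_is_surj surj_f_inv_f)
  show "inv P (x + y) = inv P x + inv P y" for x y
    by (rule injD[OF bij_is_inj[OF P(2)]]) (simp add: PQ linear_add[OF P(1)])
  show "inv P (r *\<^sub>R x) = r *\<^sub>R inv P x" for r x
    by (rule injD[OF bij_is_inj[OF P(2)]]) (simp add: PQ linear_cmul[OF P(1)])
qed

lemma kaehler_transfer: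
  fixes P :: "'b::real_vector \<Rightarrow> 'a::real_vector"
  assumes P: "linear P" "bij P" and K: "kaehler br J \<omega>"
  defines "br' \<equiv> \<lambda>x y. inv P (br (P x) (P y))" and "J' \<equiv> \<lambda>x. inv P (J (P x))"
  shows "kaehler br' J' (\<lambda>x y. \<omega> (P x) (P y))" "equivalent br J br' J'"
proof -
  note D = kaehler_def lie_algebra_def complex_structure_def symplectic_structure_def compatible_def
  have PQ: "P (inv P x) = x" for x using P by (simp add: bij_is_surj surj_f_inv_f)
  have QP: "inv P (P x) = x" for x using P by (simp add: bij_is_inj)
  have Q: "linear (inv P)" by (rule linear_inv_bij[OF P])
  note Pl = linear_add[OF P(1)] linear_diff[OF P(1)] linear_cmul[OF P(1)] linear_neg[OF P(1)] linear_0[OF P(1)]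
  note Ql = linear_add[OF Q] linear_diff[OF Q] linear_cmul[OF Q] linear_neg[OF Q] linear_0[OF Q]
  from K have bil: "bilinear br" "bilinear \<omega>" and J: "linear J" by (auto simp: D)
  note bl = bilinear_ladd[OF bil(1)] bilinear_radd[OF bil(1)] bilinear_lmul[OF bil(1)] bilinear_rmul[OF bil(1)]
    bilinear_ladd[OF bil(2)] bilinear_radd[OF bil(2)] bilinear_lmul[OF bil(2)] bilinear_rmul[OF bil(2)]
    linear_add[OF J] linear_cmul[OF J]
  have Pinj: "u = v" if "P u = P v" for u v using P(2) that by (simp add: bij_def inj_eq)
  have P': "P (br' x y) = br (P x) (P y)" "P (J' x) = J (P x)" for x y by (simp_all add: br'_def J'_def PQ)
  have lie: "bilinear br" "\<And>x. br x x = 0" "\<And>x y z. br x (br y z) + br y (br z x) + br z (br x y) = 0"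
    and cs: "\<And>x. J (J x) = - x" "\<And>x y. br (J x) (J y) - br x y - J (br (J x) y) - J (br x (J y)) = 0"
    using K unfolding D by blast+
  have bil': "bilinear br'"
    unfolding bilinear_def by (auto intro!: linearI Pinj simp: P' Pl bl)
  moreover have "br' x x = 0" for x by (rule Pinj) (simp add: P' Pl lie)
  moreover have "br' x (br' y z) + br' y (br' z x) + br' z (br' x y) = 0" for x y z
    by (rule Pinj) (simp add: P' Pl lie)
  ultimately have "lie_algebra br'" by (simp add: lie_algebra_def)
  moreover have "linear J'" by (auto intro!: linearI Pinj simp: P' Pl bl)
  then have "complex_structure br' J'"
    unfolding complex_structure_def using cs by (auto intro!: Pinj simp: P' Pl)
  moreover have "\<exists>y. \<omega> (P x) (P y) \<noteq> 0" if "x \<noteq> 0" for x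
  proof -
    have "P x \<noteq> 0" using that QP[of x] Ql(5) by auto
    then obtain y where "\<omega> (P x) y \<noteq> 0" using K unfolding D by blast
    then show ?thesis using PQ[of y] by metis
  qed
  then have "symplectic_structure br' (\<lambda>x y. \<omega> (P x) (P y))"
    using K unfolding D by (auto simp: P' bilinear_def linear_iff Pl bl)
  moreover have "compatible J' (\<lambda>x y. \<omega> (P x) (P y))"
    using K unfolding D by (auto simp: J'_def PQ)
  ultimately show "kaehler br' J' (\<lambda>x y. \<omega> (P x) (P y))" by (simp add: kaehler_def)
  show "equivalent br J br' J'" unfolding equivalent_def
    by (intro exI[of _ "inv P"]) (simp add: Q P bij_imp_bij_inv br'_def J'_def PQ)
qed

abbreviation J0 :: "real^4 \<Rightarrow> real^4" where
  "J0 \<equiv> \<lambda>x. vector [- x$2, x$1, - x$4, x$3]"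

text \<open>The frame becomes the standard basis, with \<open>e\<^sub>1, e\<^sub>2\<close> in the role of \<open>w, J w\<close> and \<open>e\<^sub>3, e\<^sub>4\<close>
  in that of \<open>z, J z\<close>. The two alternatives are the nondegenerate and the isotropic case.\<close>

lemma normal_form_exists:
  fixes br :: "real^4 \<Rightarrow> real^4 \<Rightarrow> real^4"
  assumes K: "kaehler br J \<omega>"
  shows "\<exists>br' \<omega>'. kaehler br' J0 \<omega>' \<and> equivalent br J br' J0 \<and>
    (\<forall>x y. br' x y $ 4 = 0) \<and> ad_trace br' (e 1) = 0 \<and> ad_trace br' (e 2) = 0 \<and> ad_trace br' (e 3) = 0 \<and>
    (\<omega>' (e 1) (e 2) \<noteq> 0 \<and> \<omega>' (e 3) (e 1) = 0 \<and> \<omega>' (e 3) (e 2) = 0 \<and> \<omega>' (br' (e 3) (e 1)) (e 2) = 0 \<and>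
      (\<omega>' (e 1) (br' (e 3) (e 1)))\<^sup>2 \<le> (\<omega>' (e 2) (br' (e 3) (e 2)))\<^sup>2 \<or>
     \<omega>' (e 1) (e 2) = 0 \<and> \<omega>' (e 3) (e 1) = 1 \<and> \<omega>' (e 3) (e 2) = 0 \<and> \<omega>' (e 3) (e 4) = 0 \<and>
      (\<omega>' (br' (e 1) (e 2)) (e 1) \<noteq> 0 \<longrightarrow> \<omega>' (br' (e 1) (e 2)) (e 3) = 0))"
proof -
  note D = kaehler_def lie_algebra_def complex_structure_def symplectic_structure_def compatible_def
  have lie: "lie_algebra br" using K by (simp add: kaehler_def)
  from K have J: "linear J" "\<And>x. J (J x) = - x"
    and om: "bilinear \<omega>" "\<And>x. \<omega> x x = 0" "\<And>x. x \<noteq> 0 \<Longrightarrow> \<exists>y. \<omega> x y \<noteq> 0" "\<And>x y. \<omega> (J x) (J y) = \<omega> x y"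
    and br: "bilinear br" "\<And>x. br x x = 0"
    and closed: "\<And>x y z. \<omega> (br x y) z + \<omega> (br y z) x + \<omega> (br z x) y = 0"
    unfolding D by auto
  obtain \<tau> where \<tau>: "\<tau> \<noteq> 0" "\<And>x y. \<tau> \<bullet> br x y = 0" "\<And>x. \<tau> \<bullet> x = 0 \<Longrightarrow> ad_trace br x = 0"
    using unimodular_ideal_exists[OF lie] by blast
  define good where "good w z \<longleftrightarrow>
    \<omega> w (J w) \<noteq> 0 \<and> \<omega> z w = 0 \<and> \<omega> z (J w) = 0 \<and>
     \<omega> (br z w) (J w) = 0 \<and> (\<omega> w (br z w))\<^sup>2 \<le> (\<omega> (J w) (br z (J w)))\<^sup>2 \<or>
     \<omega> w (J w) = 0 \<and> \<omega> z w = 1 \<and> \<omega> z (J w) = 0 \<and> \<omega> z (J z) = 0 \<and>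
     (\<omega> (br w (J w)) w \<noteq> 0 \<longrightarrow> \<omega> (br w (J w)) z = 0)" for w z
  obtain w0 z0 where A0: "adapted_frame J \<tau> w0 z0" using adapted_frame_exists[OF J \<tau>(1)] by blast
  have "\<exists>w z. adapted_frame J \<tau> w z \<and> good w z"
  proof (cases "\<omega> w0 (J w0) = 0")
    case True
    from isotropic_frame_exists[OF J br(2) om br(1) closed \<tau>(1,2) A0 True] show ?thesis
      unfolding good_def by blast
  next
    case False
    from orthogonal_frame_exists[OF J br(2) om br(1) closed \<tau>(1,2) A0 False]
    show ?thesis unfolding good_def by blast
  qed
  then obtain w z where A: "adapted_frame J \<tau> w z" and good: "good w z" by blast
  define P where "P = frame_map J w z"
  have P: "linear P" "bij P"
    using linear_frame_map frame_map_inj[OF J A] frame_map_surj[OF J A] by (auto simp: P_def bij_def)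
  have PQ: "P (inv P x) = x" for x using P by (simp add: bij_is_surj surj_f_inv_f)
  have QP: "inv P (P x) = x" for x using P by (simp add: bij_is_inj)
  have Q: "linear (inv P)" by (rule linear_inv_bij[OF P])
  define br' where "br' x y = inv P (br (P x) (P y))" for x y
  define \<omega>' where "\<omega>' x y = \<omega> (P x) (P y)" for x y
  have Pe: "P (e 1) = w" "P (e 2) = J w" "P (e 3) = z" "P (e 4) = J z"
    by (simp_all add: P_def frame_map_def axis_def)
  have "J (P x) = P (J0 x)" for x
    by (simp add: P_def frame_map_def linear_add[OF J(1)] linear_cmul[OF J(1)] J(2))
  then have J0: "(\<lambda>x. inv P (J (P x))) = J0" by (simp add: QP)
  have "br' x y $ 4 = 0" for x y
  proof -
    have "\<tau> \<bullet> P (br' x y) = 0" by (simp add: br'_def PQ \<tau>)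
    then show ?thesis using A by (simp add: P_def frame_map_def adapted_frame_def inner_add_right)
  qed
  moreover have tr: "ad_trace br' x = ad_trace br (P x)" for x
    unfolding br'_def by (rule ad_trace_conj[OF lie P(1) Q PQ])
  moreover have "ad_trace br' (e 1) = 0" "ad_trace br' (e 2) = 0" "ad_trace br' (e 3) = 0"
    unfolding tr Pe using \<tau>(3) A by (simp_all add: adapted_frame_def)
  moreover have "kaehler br' J0 \<omega>'" "equivalent br J br' J0"
    using kaehler_transfer[OF P K] unfolding J0 br'_def[symmetric] \<omega>'_def[symmetric] by auto
  ultimately show ?thesis using good unfolding good_def
    by (intro exI[of _ br'] exI[of _ \<omega>']) (simp add: \<omega>'_def Pe br'_def PQ)
qed

section \<open>The bracket in an adapted frame\<close>

text \<open>Identify the span of \<open>e\<^sub>1, e\<^sub>2\<close> with the complex numbers and let \<open>\<sigma>\<close> be the conjugation.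
  Modulo \<open>e\<^sub>3\<close>, \<open>ad e\<^sub>3\<close> acts on it as \<open>i n + (r + i s) \<sigma>\<close> and \<open>ad e\<^sub>4\<close> as
  \<open>a1 + i a2 + i (r + i s) \<sigma>\<close>. The factor \<open>i\<close> between the two antilinear parts, and the
  coefficients of \<open>e\<^sub>3\<close> in the brackets with \<open>e\<^sub>4\<close>, come from the integrability of \<open>J\<close>. The
  missing real part in \<open>ad e\<^sub>3\<close> and the components of \<open>[e\<^sub>1, e\<^sub>2]\<close> along \<open>e\<^sub>1, e\<^sub>2\<close> come
  from the unimodularity of the ideal.\<close>

definition std_br :: "real \<Rightarrow> real \<Rightarrow> real \<Rightarrow> real \<Rightarrow> real \<Rightarrow> real \<Rightarrow> real \<Rightarrow> real \<Rightarrow> real \<Rightarrow> real \<Rightarrow> real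
    \<Rightarrow> real^4 \<Rightarrow> real^4 \<Rightarrow> real^4" where
  "std_br q b1 b2 r n s a1 a2 u1 u2 p x y =
     ew 1 2 x y *\<^sub>R vector [- b2, b1, q, 0] +
     ew 3 1 x y *\<^sub>R vector [r, n + s, b1, 0] + ew 3 2 x y *\<^sub>R vector [s - n, - r, b2, 0] +
     ew 4 1 x y *\<^sub>R vector [a1 - s, a2 + r, - b2, 0] + ew 4 2 x y *\<^sub>R vector [r - a2, a1 + s, b1, 0] +
     ew 4 3 x y *\<^sub>R vector [u1, u2, p, 0]"

lemma std_br_jacobi:
  assumes "lie_algebra (std_br q b1 b2 r n s a1 a2 u1 u2 p)"
  shows "q * (p - 2 * a1) + 2 * (b1\<^sup>2 + b2\<^sup>2) = 0"
    and "q * u1 = (a2 - 2 * r) * b1 - (a1 + 2 * s - n) * b2"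
    and "q * u2 = (a2 + 2 * r) * b2 + (a1 - 2 * s - n) * b1"
    and "2 * (r\<^sup>2 + s\<^sup>2) + u2 * b1 - u1 * b2 = p * n"
    and "2 * (n * r - a2 * s) + u1 * b1 - u2 * b2 = p * r"
    and "2 * (n * s + a2 * r) + u1 * b2 + u2 * b1 = p * s"
proof -
  let ?b = "std_br q b1 b2 r n s a1 a2 u1 u2 p"
  have "?b x (?b y z) + ?b y (?b z x) + ?b z (?b x y) = 0" for x y z
    using assms by (simp add: lie_algebra_def)
  note j = this[of "e 4" "e 1" "e 2"] this[of "e 4" "e 3" "e 1"] this[of "e 4" "e 3" "e 2"]
  note j = j[unfolded vec_eq_iff forall_4 std_br_def ew_def, simplified axis_def, simplified]
  show "q * (p - 2 * a1) + 2 * (b1\<^sup>2 + b2\<^sup>2) = 0"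
    "q * u1 = (a2 - 2 * r) * b1 - (a1 + 2 * s - n) * b2"
    "q * u2 = (a2 + 2 * r) * b2 + (a1 - 2 * s - n) * b1"
    using j(1) by algebra+
  show "2 * (r\<^sup>2 + s\<^sup>2) + u2 * b1 - u1 * b2 = p * n"
    "2 * (n * r - a2 * s) + u1 * b1 - u2 * b2 = p * r"
    "2 * (n * s + a2 * r) + u1 * b2 + u2 * b1 = p * s"
    using j(2,3) by algebra+
qed

lemma std_br_exists:
  assumes K: "kaehler br J0 \<omega>" and c4: "\<And>x y. br x y $ 4 = 0"
    and tr: "ad_trace br (e 1) = 0" "ad_trace br (e 2) = 0" "ad_trace br (e 3) = 0"
  shows "\<exists>q b1 b2 r n s a1 a2 u1 u2 p. br = std_br q b1 b2 r n s a1 a2 u1 u2 p"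
proof -
  note D = kaehler_def lie_algebra_def complex_structure_def
  from K have bil: "bilinear br" and alt: "\<And>x. br x x = 0" and
    N: "\<And>x y. br (J0 x) (J0 y) - br x y - J0 (br (J0 x) y) - J0 (br x (J0 y)) = 0" unfolding D by auto
  note sw = alternating_swap[OF bil alt]
  define c where "c i j k = br (e i) (e j) $ k" for i j k
  have csw: "c i j k = - c j i k" for i j k using sw[of "e j" "e i"] by (simp add: c_def)
  have c0: "c i i k = 0" for i k by (simp add: c_def alt)
  have c4: "c i j 4 = 0" for i j by (simp add: c_def c4)
  have ve: "br (e i) (e j) = vector [c i j 1, c i j 2, c i j 3, c i j 4]" for i j
    by (simp add: vec_eq_iff forall_4 c_def)
  have J0e: "J0 (e 1) = e 2" "J0 (e 2) = - e 1" "J0 (e 3) = e 4" "J0 (e 4) = - e 3"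
    by (simp_all add: vec_eq_iff forall_4 axis_def)
  have tr: "c 1 2 2 + c 1 3 3 = 0" "c 2 1 1 + c 2 3 3 = 0" "c 3 1 1 + c 3 2 2 = 0"
    using tr by (simp_all add: ad_trace_eq c_def[symmetric] c0 c4)
  have int: "c 2 4 1 - c 1 3 1 + c 2 3 2 + c 1 4 2 = 0" "c 2 4 2 - c 1 3 2 - c 2 3 1 - c 1 4 1 = 0"
     "c 2 4 3 - c 1 3 3 = 0" "c 2 3 3 + c 1 4 3 = 0"
    using N[of "e 1" "e 3"] unfolding J0e ve by (simp_all add: vec_eq_iff forall_4 c4)
  let ?b = "std_br (c 1 2 3) (c 3 1 3) (c 3 2 3) (c 3 1 1) ((c 3 1 2 - c 3 2 1) / 2) ((c 3 1 2 + c 3 2 1) / 2)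
    ((c 4 1 1 + c 4 2 2) / 2) ((c 4 1 2 - c 4 2 1) / 2) (c 4 3 1) (c 4 3 2) (c 4 3 3)"
  have "br x y = ?b x y" for x y
  proof (rule alternating_eqI[OF bil alt])
    show "bilinear ?b" by (auto simp: bilinear_def linear_iff std_br_def ew_def vec_eq_iff forall_4 algebra_simps)
    show "?b x x = 0" for x by (simp add: std_br_def ew_def)
  qed (unfold ve, use tr int in \<open>simp_all add: std_br_def ew_def axis_def vec_eq_iff forall_4 c4
         csw[of 1 3] csw[of 1 4] csw[of 2 3] csw[of 2 4] csw[of 3 4] csw[of 2 1] field_simps\<close>)
  then have "br = ?b" by blast
  then show ?thesis by blast
qed

section \<open>Solving the structure equations\<close>

text \<open>The closedness of \<open>\<omega> = k e\<^sup>1\<^sup>2 + m e\<^sup>3\<^sup>4\<close>, with \<open>\<kappa> = k / m\<close>. The rotation of \<open>w\<close> yields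
  \<open>r = 0\<close> and \<open>s n \<le> 0\<close>.\<close>

lemma std_br_orthogonal:
  assumes b: "br = std_br q b1 b2 r n s a1 a2 u1 u2 p" and K: "kaehler br J0 \<omega>"
    and k: "\<omega> (e 1) (e 2) \<noteq> 0" and o: "\<omega> (e 3) (e 1) = 0" "\<omega> (e 3) (e 2) = 0"
    and r: "\<omega> (br (e 3) (e 1)) (e 2) = 0"
    and le: "(\<omega> (e 1) (br (e 3) (e 1)))\<^sup>2 \<le> (\<omega> (e 2) (br (e 3) (e 2)))\<^sup>2"
  shows "\<exists>\<kappa>. \<kappa> \<noteq> 0 \<and> r = 0 \<and> b1 = \<kappa> * u2 \<and> b2 = - \<kappa> * u1 \<and> q = - 2 * \<kappa> * a1 \<and> s * n \<le> 0"
proof -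
  note D = kaehler_def symplectic_structure_def compatible_def
  have om: "bilinear \<omega>" "\<And>x. \<omega> x x = 0" and nondeg: "\<forall>x. x \<noteq> 0 \<longrightarrow> (\<exists>y. \<omega> x y \<noteq> 0)"
    and herm: "\<And>x y. \<omega> (J0 x) (J0 y) = \<omega> x y"
    and closed: "\<And>x y z. \<omega> (br x y) z + \<omega> (br y z) x + \<omega> (br z x) y = 0"
    using K unfolding D by blast+
  obtain k b c d f m where \<omega>: "\<omega> = form6 k b c d f m" using alternating_form6[OF om] by blast
  have z: "b = 0" "d = 0" "c = 0" "f = 0"
    using o herm[of "e 1" "e 3"] herm[of "e 1" "e 4"]
    by (simp_all add: \<omega> form6_def ew_def axis_def)
  have "k \<noteq> 0" using k by (simp add: \<omega> form6_def ew_def axis_def)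
  moreover have "m \<noteq> 0" using nondeg unfolding \<omega> form6_nondegenerate by (simp add: z)
  ultimately have km: "k / m \<noteq> 0" "m \<noteq> 0" "k \<noteq> 0" by auto
  have "r = 0" using r km by (simp add: \<omega> form6_def ew_def b std_br_def axis_def z)
  moreover have "q = - 2 * (k / m) * a1"
    using closed[of "e 4" "e 1" "e 2"] km
    by (simp add: \<omega> form6_def ew_def b std_br_def axis_def z field_simps)
  moreover have "b1 = (k / m) * u2" "b2 = - (k / m) * u1"
    using closed[of "e 4" "e 3" "e 1"] closed[of "e 4" "e 3" "e 2"] km
    by (simp_all add: \<omega> form6_def ew_def b std_br_def axis_def z field_simps)
  moreover have "(k * (n + s))\<^sup>2 \<le> (k * (n - s))\<^sup>2"
    using le by (simp add: \<omega> form6_def ew_def b std_br_def axis_def z)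
  then have "(n + s)\<^sup>2 \<le> (n - s)\<^sup>2" using km by (simp add: power_mult_distrib)
  then have "s * n \<le> 0" by (simp add: power2_eq_square algebra_simps)
  ultimately show ?thesis using km by blast
qed

lemma std_br_isotropic:
  assumes b: "br = std_br q b1 b2 r n s a1 a2 u1 u2 p" and K: "kaehler br J0 \<omega>"
    and k: "\<omega> (e 1) (e 2) = 0" and o: "\<omega> (e 3) (e 1) = 1" "\<omega> (e 3) (e 2) = 0" "\<omega> (e 3) (e 4) = 0"
    and q: "\<omega> (br (e 1) (e 2)) (e 1) \<noteq> 0 \<longrightarrow> \<omega> (br (e 1) (e 2)) (e 3) = 0"
  shows "b1 = 0" "a2 = 2 * r" "p = n + 2 * s - a1" "q \<noteq> 0 \<Longrightarrow> b2 = 0"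
proof -
  note D = kaehler_def symplectic_structure_def compatible_def
  have om: "bilinear \<omega>" "\<And>x. \<omega> x x = 0"
    and herm: "\<And>x y. \<omega> (J0 x) (J0 y) = \<omega> x y"
    and closed: "\<And>x y z. \<omega> (br x y) z + \<omega> (br y z) x + \<omega> (br z x) y = 0"
    using K unfolding D by blast+
  obtain k b c d f m where \<omega>: "\<omega> = form6 k b c d f m" using alternating_form6[OF om] by blast
  have z: "b = -1" "d = 0" "c = 0" "f = -1" "k = 0" "m = 0"
    using o k herm[of "e 1" "e 3"] herm[of "e 1" "e 4"]
    by (simp_all add: \<omega> form6_def ew_def axis_def)
  show "b1 = 0" using closed[of "e 4" "e 1" "e 2"]
    by (simp add: \<omega> form6_def ew_def b std_br_def axis_def z)
  show "p = n + 2 * s - a1" using closed[of "e 4" "e 3" "e 1"]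
    by (simp add: \<omega> form6_def ew_def b std_br_def axis_def z)
  show "a2 = 2 * r" using closed[of "e 4" "e 3" "e 2"]
    by (simp add: \<omega> form6_def ew_def b std_br_def axis_def z)
  show "b2 = 0" if "q \<noteq> 0" using q that
    by (simp add: \<omega> form6_def ew_def b std_br_def axis_def z)
qed

text \<open>The hypotheses are the Jacobi identity for the brackets of \<open>std_br_orthogonal\<close>. Write
  \<open>u = u1 + i u2\<close>. For \<open>u = 0\<close> the equations factor. For \<open>u \<noteq> 0\<close>, the equations \<open>e2\<close> and \<open>e3\<close>
  determine \<open>s \<sigma> u / u\<close>; this eliminates \<open>u\<close> from all the other equations except
  for \<open>D = \<bar>u\<bar>\<^sup>2\<close>, and leaves \<open>n = a1\<close>. The sign condition selects one of the two solutions
  that a rotation of \<open>w\<close> by \<open>i\<close> exchanges.\<close>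

lemma orthogonal_solutions:
  fixes \<kappa> n s a1 a2 u1 u2 p :: real
  assumes \<kappa>: "\<kappa> \<noteq> 0" and sn: "s * n \<le> 0"
    and e1: "\<kappa> * (u1\<^sup>2 + u2\<^sup>2) = a1 * (p - 2 * a1)"
    and e2: "(n - 3 * a1 - 2 * s) * u1 = a2 * u2"
    and e3: "(n - 3 * a1 + 2 * s) * u2 = - a2 * u1"
    and e4: "2 * s\<^sup>2 + \<kappa> * (u1\<^sup>2 + u2\<^sup>2) = p * n"
    and e5: "(2 * n - p) * s = \<kappa> * (u1\<^sup>2 - u2\<^sup>2)"
    and e6: "a2 * s = \<kappa> * u1 * u2"
  shows "u1 = 0 \<and> u2 = 0 \<and> s = 0 \<and> p = 0 \<and> a1 = 0 \<or>
    u1 = 0 \<and> u2 = 0 \<and> s = 0 \<and> p \<noteq> 0 \<and> n = 0 \<and> (a1 = 0 \<or> p = 2 * a1) \<or>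
    u1 = 0 \<and> u2 = 0 \<and> n \<noteq> 0 \<and> s = - n \<and> p = 2 * n \<and> a1 = 0 \<and> a2 = 0 \<or>
    n \<noteq> 0 \<and> s = - n \<and> a1 = n \<and> a2 = 0 \<and> u2 = 0 \<and> \<kappa> * u1\<^sup>2 = n * (p - 2 * n)"
proof (cases "u1 = 0 \<and> u2 = 0")
  case True
  then have e: "a1 = 0 \<or> p = 2 * a1" "2 * s\<^sup>2 = p * n" "2 * n = p \<or> s = 0" "a2 = 0 \<or> s = 0"
    using e1 e4 e5 e6 by auto
  show ?thesis
  proof (cases "s = 0")
    case s: True
    then have "p = 0 \<or> n = 0" using e by simp
    then show ?thesis using e(1) s True by auto
  next
    case s: False
    then have p: "p = 2 * n" "a2 = 0" and "s\<^sup>2 = n\<^sup>2" using e by (auto simp: power2_eq_square)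
    then have "s = n \<or> s = - n" by (simp add: power2_eq_iff)
    then have n: "s = - n" "n \<noteq> 0" using sn s by (auto simp: zero_compare_simps mult_le_0_iff)
    then show ?thesis using p True e(1) by auto
  qed
next
  case False
  define D where "D = u1\<^sup>2 + u2\<^sup>2"
  have D: "D \<noteq> 0" using False by (simp add: D_def sum_power2_eq_zero_iff)
  have A: "2 * s * (u1\<^sup>2 - u2\<^sup>2) = (n - 3 * a1) * D"
  proof -
    have "(n - 3 * a1 - 2 * s) * u1 * u1 + (n - 3 * a1 + 2 * s) * u2 * u2 = 0"
      unfolding e2 e3 by simp
    then show ?thesis by (simp add: D_def power2_eq_square algebra_simps)
  qed
  have B: "4 * s * u1 * u2 = - a2 * D"
  proof -
    have "(n - 3 * a1 - 2 * s) * u1 * u2 - (n - 3 * a1 + 2 * s) * u2 * u1 = a2 * D"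
      unfolding e2 e3 by (simp add: D_def power2_eq_square algebra_simps)
    then show ?thesis by (simp add: algebra_simps)
  qed
  have A': "(2 * n - p) * (2 * s\<^sup>2) = (n - 3 * a1) * (\<kappa> * D)"
    using e5 A by algebra
  have B': "a2 * (4 * s\<^sup>2 + \<kappa> * D) = 0"
    using e6 B by algebra
  have e1: "\<kappa> * D = a1 * (p - 2 * a1)" and e4: "2 * s\<^sup>2 + \<kappa> * D = p * n" using e1 e4 by (simp_all add: D_def)
  have s0: "s \<noteq> 0"
  proof
    assume s: "s = 0"
    then have "u1\<^sup>2 = u2\<^sup>2" "u1 * u2 = 0" using e5 e6 \<kappa> by auto
    then show False using False by auto
  qed
  have a2: "a2 = 0"
  proof (rule ccontr)
    assume "a2 \<noteq> 0"
    then have kD: "\<kappa> * D = - 4 * s\<^sup>2" using B' by auto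
    have "s\<^sup>2 * (2 * n - p + 2 * (n - 3 * a1)) = 0" using A' unfolding kD by algebra
    then have p: "p = 4 * n - 6 * a1" using s0 by auto
    have "(n - a1)\<^sup>2 = 0" using e1 e4 kD p by algebra
    then have n: "a1 = n" by simp
    have "s\<^sup>2 = n\<^sup>2" using e4 kD p n by algebra
    then have "s = n \<or> s = - n" by (simp add: power2_eq_iff)
    then have s: "s = - n" using sn s0 by (auto simp: mult_le_0_iff)
    have "a2 = 0 \<or> u2 = 0" using e2 unfolding s n by simp
    moreover have "4 * n * u2 = a2 * u1" using e3 unfolding s n by simp
    ultimately show False using \<open>a2 \<noteq> 0\<close> False by auto
  qed
  have "u1 * u2 = 0" using B s0 a2 by auto
  moreover have "\<not> u1 = 0"
  proof
    assume u1: "u1 = 0"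
    then have u2: "u2 \<noteq> 0" using False by blast
    have s: "2 * s = - (n - 3 * a1)" using e3 u1 u2 by simp
    have kD: "(2 * n - p) * s = - (\<kappa> * D)" using e5 u1 by (simp add: D_def)
    have 1: "(n - a1) * (2 * n - 4 * a1 - p) = 0" using s kD e1 by algebra
    have 2: "(n - a1) * (n - 5 * a1 - 2 * p) = 0" using s e4 e1 by algebra
    have "n = a1"
    proof (rule ccontr)
      assume "n \<noteq> a1"
      then have "2 * n = 4 * a1 + p" "n = 5 * a1 + 2 * p" using 1 2 by auto
      then show False using \<open>n \<noteq> a1\<close> by linarith
    qed
    then have "s = n" using s by simp
    then show False using sn s0 by (auto simp: mult_le_0_iff)
  qed
  ultimately have u: "u2 = 0" "u1 \<noteq> 0" by auto
  have s: "2 * s = n - 3 * a1" using e2 u by simp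
  have kD: "(2 * n - p) * s = \<kappa> * D" using e5 u by (simp add: D_def)
  have 1: "(n - a1) * (2 * n - 4 * a1 - p) = 0" using s kD e1 by algebra
  have 2: "(n - a1) * (n - 5 * a1 - 2 * p) = 0" using s e4 e1 by algebra
  have "n = a1"
  proof (rule ccontr)
    assume "n \<noteq> a1"
    then have "2 * n = 4 * a1 + p" "n = 5 * a1 + 2 * p" using 1 2 by auto
    then show False using \<open>n \<noteq> a1\<close> by linarith
  qed
  then show ?thesis using s s0 a2 u e1 by (auto simp: D_def)
qed

lemma isotropic_solutions:
  fixes q n r s a1 u1 u2 p :: real
  assumes p: "p = n + 2 * s - a1"
    and e1: "q * (p - 2 * a1) = 0"
    and e4: "2 * (r\<^sup>2 + s\<^sup>2) = p * n"
    and e5: "2 * (n * r - 2 * r * s) = p * r"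
    and e6: "2 * (n * s + 2 * r * r) = p * s"
  shows "r = 0"
    "s = 0 \<and> n = 0 \<and> p = - a1 \<and> (q = 0 \<or> a1 = 0) \<or> s = 0 \<and> n = a1 \<and> n \<noteq> 0 \<and> p = 0 \<and> q = 0 \<or>
     s \<noteq> 0 \<and> a1 = s \<and> n = s \<and> p = 2 * s \<or> s \<noteq> 0 \<and> a1 = 3 * s \<and> n = - s \<and> p = - 2 * s \<and> q = 0"
proof -
  show r: "r = 0"
  proof (rule ccontr)
    assume "r \<noteq> 0"
    moreover have "r * (n - 6 * s + a1) = 0" using e5 p by algebra
    ultimately have "n = 6 * s - a1" by auto
    then have "r\<^sup>2 + s\<^sup>2 = 0" using e6 p by algebra
    then show False using \<open>r \<noteq> 0\<close> by (simp add: sum_power2_eq_zero_iff)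
  qed
  have e6': "s = 0 \<or> n = 2 * s - a1"
  proof -
    have "s * (n - 2 * s + a1) = 0" using e6 p r by algebra
    then show ?thesis by auto
  qed
  show "s = 0 \<and> n = 0 \<and> p = - a1 \<and> (q = 0 \<or> a1 = 0) \<or> s = 0 \<and> n = a1 \<and> n \<noteq> 0 \<and> p = 0 \<and> q = 0 \<or>
     s \<noteq> 0 \<and> a1 = s \<and> n = s \<and> p = 2 * s \<or> s \<noteq> 0 \<and> a1 = 3 * s \<and> n = - s \<and> p = - 2 * s \<and> q = 0"
  proof (cases "s = 0")
    case True
    then show ?thesis using e4 e1 p r by auto
  next
    case False
    then have n: "n = 2 * s - a1" using e6' by blast
    have "(a1 - s) * (a1 - 3 * s) = 0" using e4 p r n by algebra
    then have "a1 = s \<or> a1 = 3 * s" by auto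
    then show ?thesis using False n p e1 by auto
  qed
qed

section \<open>Frames that realise the listed brackets\<close>

definition frame4 :: "real^4 \<Rightarrow> real^4 \<Rightarrow> real^4 \<Rightarrow> real^4 \<Rightarrow> real^4 \<Rightarrow> real^4" where
  "frame4 f1 f2 f3 f4 x = x$1 *\<^sub>R f1 + x$2 *\<^sub>R f2 + x$3 *\<^sub>R f3 + x$4 *\<^sub>R f4"

lemma frame4_nth: "frame4 f1 f2 f3 f4 x $ i = x$1 * f1$i + x$2 * f2$i + x$3 * f3$i + x$4 * f4$i"
  by (simp add: frame4_def)

lemma equivalent_by_frame:
  assumes lie: "lie_algebra br" "lie_algebra br'" and lin: "linear J" "linear J'"
    and inj: "\<And>x. frame4 f1 f2 f3 f4 x = 0 \<Longrightarrow> x$1 = 0 \<and> x$2 = 0 \<and> x$3 = 0 \<and> x$4 = 0"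
    and br: "br f1 f2 = frame4 f1 f2 f3 f4 (br' (e 1) (e 2))" "br f1 f3 = frame4 f1 f2 f3 f4 (br' (e 1) (e 3))"
      "br f1 f4 = frame4 f1 f2 f3 f4 (br' (e 1) (e 4))" "br f2 f3 = frame4 f1 f2 f3 f4 (br' (e 2) (e 3))"
      "br f2 f4 = frame4 f1 f2 f3 f4 (br' (e 2) (e 4))" "br f3 f4 = frame4 f1 f2 f3 f4 (br' (e 3) (e 4))"
    and J: "J f1 = frame4 f1 f2 f3 f4 (J' (e 1))" "J f2 = frame4 f1 f2 f3 f4 (J' (e 2))"
      "J f3 = frame4 f1 f2 f3 f4 (J' (e 3))" "J f4 = frame4 f1 f2 f3 f4 (J' (e 4))"
  shows "equivalent br J br' J'"
proof -
  define P where "P = frame4 f1 f2 f3 f4"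
  have P: "linear P" by (simp add: P_def frame4_def linear_iff algebra_simps)
  have "x = 0" if "P x = 0" for x
    using inj[of x] that unfolding P_def vec_eq_iff forall_4 zero_index by blast
  then have "inj P" using linear_injective_0[OF P] by blast
  then have bij: "bij P" using linear_inj_imp_surj[OF P] by (simp add: bij_def)
  have PQ: "P (inv P x) = x" for x using bij by (simp add: bij_is_surj surj_f_inv_f)
  have QP: "inv P (P x) = x" for x using bij by (simp add: bij_is_inj)
  have Pe: "P (e 1) = f1" "P (e 2) = f2" "P (e 3) = f3" "P (e 4) = f4"
    by (simp_all add: P_def frame4_def axis_def)
  have bil: "bilinear br" "\<And>x. br x x = 0" "bilinear br'" "\<And>x. br' x x = 0"
    using lie by (auto simp: lie_algebra_def)
  note rules = bilinear_ladd[OF bil(1)] bilinear_radd[OF bil(1)] bilinear_lmul[OF bil(1)]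
    bilinear_rmul[OF bil(1)] bilinear_ladd[OF bil(3)] bilinear_radd[OF bil(3)] bilinear_lmul[OF bil(3)]
    bilinear_rmul[OF bil(3)] linear_add[OF P] linear_cmul[OF P]
  have PB: "br (P x) (P y) = P (br' x y)" for x y
  proof (rule alternating_eqI[where B = "\<lambda>x y. br (P x) (P y)" and C = "\<lambda>x y. P (br' x y)"])
    show "bilinear (\<lambda>x y. br (P x) (P y))" "bilinear (\<lambda>x y. P (br' x y))"
      by (simp_all add: bilinear_def linear_iff rules)
  qed (simp_all add: bil(2,4) linear_0[OF P] Pe br P_def[symmetric])
  have "J (P x) = P (J' x)" for x
  proof -
    have "J (P (x$1 *\<^sub>R e 1 + x$2 *\<^sub>R e 2 + x$3 *\<^sub>R e 3 + x$4 *\<^sub>R e 4)) =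
        P (J' (x$1 *\<^sub>R e 1 + x$2 *\<^sub>R e 2 + x$3 *\<^sub>R e 3 + x$4 *\<^sub>R e 4))"
      by (simp only: linear_add[OF P] linear_cmul[OF P] linear_add[OF lin(1)] linear_cmul[OF lin(1)]
        linear_add[OF lin(2)] linear_cmul[OF lin(2)] Pe J P_def[symmetric])
    then show ?thesis using axis_expansion[of x] by simp
  qed
  from arg_cong[OF this[of "inv P _"], of "inv P"] have "J' (inv P x) = inv P (J x)" for x
    by (simp only: PQ QP)
  moreover from arg_cong[OF PB[of "inv P _" "inv P _"], of "inv P"]
  have "inv P (br x y) = br' (inv P x) (inv P y)" for x y
    by (simp only: PQ QP)
  ultimately show ?thesis unfolding equivalent_def
    using linear_inv_bij[OF P bij] bij_imp_bij_inv[OF bij] by blast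
qed

definition listed :: "(real^4 \<Rightarrow> real^4 \<Rightarrow> real^4) \<Rightarrow> (real^4 \<Rightarrow> real^4) \<Rightarrow> bool" where
  "listed br J \<longleftrightarrow> (\<exists>br' J' \<Omega>. kaehler_model br' J' \<Omega> \<and> equivalent br J br' J')"

lemma linear_J0: "linear J0"
  by (auto intro!: linearI simp: vec_eq_iff forall_4)

lemma listedI:
  assumes "lie_algebra br" "kaehler_model br' J' \<Omega>"
    and inj: "\<And>x. frame4 f1 f2 f3 f4 x = 0 \<Longrightarrow> x$1 = 0 \<and> x$2 = 0 \<and> x$3 = 0 \<and> x$4 = 0"
    and "br f1 f2 = frame4 f1 f2 f3 f4 (br' (e 1) (e 2))" "br f1 f3 = frame4 f1 f2 f3 f4 (br' (e 1) (e 3))"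
      "br f1 f4 = frame4 f1 f2 f3 f4 (br' (e 1) (e 4))" "br f2 f3 = frame4 f1 f2 f3 f4 (br' (e 2) (e 3))"
      "br f2 f4 = frame4 f1 f2 f3 f4 (br' (e 2) (e 4))" "br f3 f4 = frame4 f1 f2 f3 f4 (br' (e 3) (e 4))"
    and "J0 f1 = frame4 f1 f2 f3 f4 (J' (e 1))" "J0 f2 = frame4 f1 f2 f3 f4 (J' (e 2))"
      "J0 f3 = frame4 f1 f2 f3 f4 (J' (e 3))" "J0 f4 = frame4 f1 f2 f3 f4 (J' (e 4))"
  shows "listed br J0"
proof -
  have lie: "lie_algebra br'" using assms(2) by cases (simp_all add: lie_models)
  have lin: "linear J'" using model_complex[OF assms(2)] by (simp add: complex_structure_def)
  have "equivalent br J0 br' J'"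
    by (rule equivalent_by_frame[OF assms(1) lie linear_J0 lin assms(3-13)])
  then show ?thesis using assms(2) unfolding listed_def by blast
qed

lemmas frame_simps = J_explicit std_br_def br_defs ew_def vec_eq_iff forall_4 frame4_nth

text \<open>Here \<open>ad e\<^sub>3\<close> and \<open>ad e\<^sub>4\<close> act on the complex line of \<open>e\<^sub>1, e\<^sub>2\<close> as the multiples \<open>i n\<close> and
  \<open>i a2\<close> of the identity. A complex multiple of \<open>e\<^sub>3\<close> acts as \<open>- i\<close>, and \<open>J\<close> of it acts as
  zero.\<close>

lemma listed_re2:
  assumes "lie_algebra (std_br 0 0 0 0 n 0 0 a2 0 0 0)" and "n \<noteq> 0 \<or> a2 \<noteq> 0"
  shows "listed (std_br 0 0 0 0 n 0 0 a2 0 0 0) J0"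
proof -
  define N where "N = n\<^sup>2 + a2\<^sup>2"
  have N: "N \<noteq> 0" using assms(2) by (auto simp: N_def sum_power2_eq_zero_iff)
  define x y where "x = - n / N" and "y = - a2 / N"
  have xy: "x * n + y * a2 = -1" "x * a2 = y * n"
    using N by (simp_all add: x_def y_def field_simps) (simp add: N_def power2_eq_square)
  then have "x \<noteq> 0 \<or> y \<noteq> 0" by auto
  then have x0: "a = 0 \<and> b = 0" if "a * x = b * y" "a * y + b * x = 0" for a b
  proof -
    have "a * (x\<^sup>2 + y\<^sup>2) = 0" "b * (x\<^sup>2 + y\<^sup>2) = 0" using that by algebra+
    moreover have "x\<^sup>2 + y\<^sup>2 \<noteq> 0" using \<open>x \<noteq> 0 \<or> y \<noteq> 0\<close> by (auto simp: sum_power2_eq_zero_iff)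
    ultimately show ?thesis by auto
  qed
  show ?thesis
    by (rule listedI[OF assms(1) re2, where ?f1.0 = "vector [0, 0, x, y]" and ?f2.0 = "e 1"
          and ?f3.0 = "e 2" and ?f4.0 = "vector [0, 0, - y, x]"])
      (simp_all add: frame_simps,
        use xy in \<open>simp_all add: axis_def\<close>,
        use x0 in blast)
qed

lemma listed_rr_aff:
  assumes "lie_algebra (std_br 0 0 0 0 0 0 0 0 0 0 p)" and "p \<noteq> 0"
  shows "listed (std_br 0 0 0 0 0 0 0 0 0 0 p) J0"
  by (rule listedI[OF assms(1) rr_aff, where ?f1.0 = "vector [0, 0, 0, 1 / p]" and ?f2.0 = "vector [0, 0, - 1 / p, 0]"
          and ?f3.0 = "e 1" and ?f4.0 = "e 2"])
      (simp_all add: frame_simps,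
        use assms(2) in \<open>simp_all add: axis_def\<close>)

lemma listed_r4':
  assumes lie: "lie_algebra (std_br 0 0 0 0 0 0 0 a2 0 0 p)" and "p \<noteq> 0" "a2 \<noteq> 0"
  shows "listed (std_br 0 0 0 0 0 0 0 a2 0 0 p) J0"
proof (cases "a2 / p < 0")
  case True
  then have pos: "- a2 / p > 0" by simp
  show ?thesis
    by (rule listedI[OF lie r4'_1[OF pos], where ?f1.0 = "vector [0, 0, - 1 / p, 0]" and ?f2.0 = "e 1"
          and ?f3.0 = "e 2" and ?f4.0 = "vector [0, 0, 0, 1 / p]"])
      (simp_all add: frame_simps,
        use assms in \<open>simp_all add: axis_def\<close>)
next
  case False
  then have pos: "a2 / p > 0" using assms by (simp add: less_le)
  show ?thesis
    by (rule listedI[OF lie r4'_2[OF pos], where ?f1.0 = "vector [0, 0, - 1 / p, 0]" and ?f2.0 = "e 1"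
          and ?f3.0 = "- e 2" and ?f4.0 = "vector [0, 0, 0, 1 / p]"])
      (simp_all add: frame_simps,
        use assms in \<open>simp_all add: axis_def\<close>)
qed

lemma listed_d4_half:
  assumes lie: "lie_algebra (std_br q 0 0 0 0 0 a1 0 0 0 (2 * a1))" and "q \<noteq> 0" "a1 \<noteq> 0"
  shows "listed (std_br q 0 0 0 0 0 a1 0 0 0 (2 * a1)) J0"
proof -
  \<comment> \<open>Rescaling \<open>e\<^sub>1, e\<^sub>2\<close> by \<open>x\<close> normalises \<open>q\<close> up to sign; the sign tells the two complex structures apart.\<close>
  define x where "x = 1 / sqrt \<bar>2 * a1 * q\<bar>"
  have x0: "x \<noteq> 0" using assms by (simp add: x_def)
  have x2: "x * x * \<bar>2 * a1 * q\<bar> = 1" using assms by (simp add: x_def power2_eq_square[symmetric] power_divide)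
  show ?thesis
  proof (cases "a1 * q < 0")
    case True
    then have x: "x * (x * q) = - 1 / (2 * a1)" using x2 assms by (simp add: field_simps)
    show ?thesis
      by (rule listedI[OF lie d4_half_1, where ?f1.0 = "vector [x, 0, 0, 0]" and ?f2.0 = "vector [0, x, 0, 0]"
            and ?f3.0 = "vector [0, 0, - 1 / (2 * a1), 0]" and ?f4.0 = "vector [0, 0, 0, 1 / (2 * a1)]"])
        (simp_all add: frame_simps,
          use assms x x0 in \<open>simp_all add: axis_def\<close>)
  next
    case False
    then have "a1 * q > 0" using assms by (simp add: less_le)
    then have x: "x * (x * q) = 1 / (2 * a1)" using x2 assms by (simp add: field_simps)
    show ?thesis
      by (rule listedI[OF lie d4_half_2, where ?f1.0 = "vector [x, 0, 0, 0]" and ?f2.0 = "vector [0, - x, 0, 0]"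
            and ?f3.0 = "vector [0, 0, - 1 / (2 * a1), 0]" and ?f4.0 = "vector [0, 0, 0, 1 / (2 * a1)]"])
        (simp_all add: frame_simps,
          use assms x x0 in \<open>simp_all add: axis_def\<close>)
  qed
qed

text \<open>The signs of \<open>a1 a2\<close> and \<open>a2 q\<close> distinguish the four complex structures; treating them as
  parameters \<open>\<sigma>\<close> and \<open>\<epsilon>\<close> handles the four cases at once.\<close>

lemma listed_d4':
  assumes lie: "lie_algebra (std_br q 0 0 0 0 0 a1 a2 0 0 (2 * a1))" and "q \<noteq> 0" "a1 \<noteq> 0" "a2 \<noteq> 0"
  shows "listed (std_br q 0 0 0 0 0 a1 a2 0 0 (2 * a1)) J0"
proof -
  define \<sigma> where "\<sigma> = - sgn (a1 * a2)"
  define \<epsilon> where "\<epsilon> = sgn (a2 * q)"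
  define y where "y = - \<sigma> / a2"
  define \<delta> where "\<delta> = 2 * a1 * y"
  define x where "x = 1 / sqrt \<bar>a2 * q\<bar>"
  have \<sigma>: "\<sigma> = 1 \<or> \<sigma> = -1" and \<epsilon>: "\<epsilon> = 1 \<or> \<epsilon> = -1" using assms by (auto simp: \<sigma>_def \<epsilon>_def sgn_if)
  have y: "y * a2 = - \<sigma>" "y \<noteq> 0" using assms \<sigma> by (auto simp: y_def)
  have "\<delta> * (a2 * a2) = 2 * (a1 * a2) * sgn (a1 * a2)" using assms by (simp add: \<delta>_def y_def \<sigma>_def)
  also have "\<dots> = 2 * \<bar>a1 * a2\<bar>" by (simp add: abs_sgn)
  finally have "0 < \<delta> * (a2 * a2)" using assms by simp
  then have \<delta>: "0 < \<delta>" using assms by (simp add: zero_less_mult_iff)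
  have x0: "x \<noteq> 0" using assms by (simp add: x_def)
  have "x * x * \<bar>a2 * q\<bar> = 1" using assms by (simp add: x_def power2_eq_square[symmetric] power_divide)
  then have "x * x * (a2 * q) * \<epsilon> = 1" by (simp add: \<epsilon>_def abs_sgn mult.assoc)
  then have "a2 * (\<sigma> * (x * (x * q))) = a2 * (- (\<epsilon> * y))"
    using y \<epsilon> by (auto simp: algebra_simps)
  then have x: "\<sigma> * (x * (x * q)) = - (\<epsilon> * y)" using mult_left_cancel[OF assms(4)] by blast
  have d: "y * a1 = \<delta> / 2" by (simp add: \<delta>_def)
  have m: "kaehler_model (br_d4' \<delta>) (J_of 4 (\<epsilon> *\<^sub>R e 3) 1 (\<sigma> *\<^sub>R e 2))
     {(\<lambda>x y. a * (ew 1 2 x y - \<delta> * ew 3 4 x y)) | a. a \<noteq> 0}"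
    using d4'_1[OF \<delta>] d4'_2[OF \<delta>] d4'_3[OF \<delta>] d4'_4[OF \<delta>] \<sigma> \<epsilon> by auto
  have J: "J_of 4 (\<epsilon> *\<^sub>R e 3) 1 (\<sigma> *\<^sub>R e 2) = (\<lambda>x. vector [- \<sigma> * x$2, \<sigma> * x$1, \<epsilon> * x$4, - \<epsilon> * x$3])"
    using \<sigma> \<epsilon> by (auto simp: J_explicit)
  show ?thesis
    by (rule listedI[OF lie m[unfolded J], where ?f1.0 = "vector [x, 0, 0, 0]" and ?f2.0 = "vector [0, \<sigma> * x, 0, 0]"
          and ?f3.0 = "vector [0, 0, - (\<epsilon> * y), 0]" and ?f4.0 = "vector [0, 0, 0, y]"])
      (simp_all add: frame_simps,
        use assms x x0 y d \<sigma> \<epsilon> in \<open>auto simp: axis_def\<close>,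
        algebra+)
qed

lemma listed_d4_two_2:
  assumes "lie_algebra (std_br 0 0 0 0 n (- n) 0 0 0 0 (2 * n))" and "n \<noteq> 0"
  shows "listed (std_br 0 0 0 0 n (- n) 0 0 0 0 (2 * n)) J0"
  by (rule listedI[OF assms(1) d4_two_2[unfolded J_41m2_23], where ?f1.0 = "vector [0, 0, 1 / (2 * n), 0]" and ?f2.0 = "e 2"
          and ?f3.0 = "- e 1" and ?f4.0 = "vector [0, 0, 0, 1 / n]"])
      (simp_all add: frame_simps,
        use assms(2) in \<open>simp_all add: axis_def\<close>)

lemma listed_rh3_1:
  assumes "lie_algebra (std_br q 0 0 0 0 0 0 0 0 0 0)" and "q \<noteq> 0"
  shows "listed (std_br q 0 0 0 0 0 0 0 0 0 0) J0"
  by (rule listedI[OF assms(1) rh3, where ?f1.0 = "e 1" and ?f2.0 = "e 2"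
          and ?f3.0 = "vector [0, 0, q, 0]" and ?f4.0 = "vector [0, 0, 0, q]"])
      (simp_all add: frame_simps,
        use assms(2) in \<open>simp_all add: axis_def\<close>)

lemma listed_rh3_2:
  assumes "lie_algebra (std_br 0 0 0 0 0 0 0 0 u1 u2 0)" and u: "u1 \<noteq> 0 \<or> u2 \<noteq> 0"
  shows "listed (std_br 0 0 0 0 0 0 0 0 u1 u2 0) J0"
proof -
  have x0: "a = 0 \<and> b = 0" if "a * u1 = b * u2" "a * u2 + b * u1 = 0" for a b
  proof -
    have "a * (u1\<^sup>2 + u2\<^sup>2) = 0" "b * (u1\<^sup>2 + u2\<^sup>2) = 0" using that by algebra+
    moreover have "u1\<^sup>2 + u2\<^sup>2 \<noteq> 0" using u by (auto simp: sum_power2_eq_zero_iff)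
    ultimately show ?thesis by auto
  qed
  show ?thesis
    by (rule listedI[OF assms(1) rh3, where ?f1.0 = "e 3" and ?f2.0 = "e 4"
          and ?f3.0 = "vector [- u1, - u2, 0, 0]" and ?f4.0 = "vector [u2, - u1, 0, 0]"])
      (simp_all add: frame_simps,
        simp_all add: axis_def,
        (rule x0; auto))
qed

text \<open>In the family of \<open>listed_algebra_2\<close>, this is the unimodular member: \<open>ad e\<^sub>4\<close> and \<open>ad e\<^sub>2\<close>
  are proportional nilpotent maps of the plane of \<open>e\<^sub>1, e\<^sub>3\<close>.\<close>

lemma listed_rh3_3:
  assumes "lie_algebra (std_br (- 2 * \<kappa> * n) 0 (- \<kappa> * u) 0 n (- n) n 0 u 0 (- 2 * n))" and "n \<noteq> 0"
    and "\<kappa> * u\<^sup>2 = - 4 * n\<^sup>2"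
  shows "listed (std_br (- 2 * \<kappa> * n) 0 (- \<kappa> * u) 0 n (- n) n 0 u 0 (- 2 * n)) J0"
proof -
  have "u \<noteq> 0" using assms by auto
  have k: "u * (\<kappa> * u) = - (4 * (n * n))" "u * u * (\<kappa> * u) = - (4 * (n * (n * u)))"
      "u * (2 * n) * (\<kappa> * u) = - (8 * (n * (n * n)))"
    using assms(3) by algebra+
  show ?thesis
    by (rule listedI[OF assms(1) rh3, where ?f1.0 = "e 3" and ?f2.0 = "e 4"
          and ?f3.0 = "vector [- u, 0, 2 * n, 0]" and ?f4.0 = "vector [0, - u, 0, 2 * n]"])
      (simp_all add: frame_simps,
        use assms(2) k \<open>u \<noteq> 0\<close> in \<open>auto simp: axis_def\<close>,
        algebra)
qed

text \<open>In this and the next three lemmas, \<open>e\<^sub>3\<close> is translated along \<open>W\<close>, and \<open>e\<^sub>4\<close> accordingly, so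
  as to absorb the components \<open>u1, u2\<close> of \<open>[e\<^sub>4, e\<^sub>3]\<close>.\<close>

lemma listed_r4:
  assumes "lie_algebra (std_br 0 0 0 0 0 0 a1 0 u1 u2 (- a1))" and "a1 \<noteq> 0"
  shows "listed (std_br 0 0 0 0 0 0 a1 0 u1 u2 (- a1)) J0"
  by (rule listedI[OF assms(1) r4, where ?f1.0 = "vector [- u1 / (2 * a1\<^sup>2), - u2 / (2 * a1\<^sup>2), 1 / a1, 0]"
          and ?f2.0 = "e 1" and ?f3.0 = "e 2" and ?f4.0 = "vector [- u2 / (2 * a1\<^sup>2), u1 / (2 * a1\<^sup>2), 0, - 1 / a1]"])
      (simp_all add: frame_simps,
        use assms(2) in \<open>auto simp: axis_def power2_eq_square\<close>)

lemma listed_affC_2: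
  assumes "lie_algebra (std_br 0 0 0 0 n 0 n 0 u1 u2 0)" and "n \<noteq> 0"
  shows "listed (std_br 0 0 0 0 n 0 n 0 u1 u2 0) J0"
  by (rule listedI[OF assms(1) affC_2, where ?f1.0 = "vector [u2 / (2 * n\<^sup>2), - u1 / (2 * n\<^sup>2), 0, 1 / n]"
          and ?f2.0 = "vector [- u1 / (2 * n\<^sup>2), - u2 / (2 * n\<^sup>2), 1 / n, 0]" and ?f3.0 = "e 1" and ?f4.0 = "e 2"])
      (simp_all add: frame_simps,
        use assms(2) in \<open>auto simp: axis_def power2_eq_square\<close>)

lemma listed_d4_one:
  assumes "lie_algebra (std_br 0 0 0 0 s s s 0 u1 u2 (2 * s))" and "s \<noteq> 0"
  shows "listed (std_br 0 0 0 0 s s s 0 u1 u2 (2 * s)) J0"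
  by (rule listedI[OF assms(1) d4_one, where ?f1.0 = "vector [u1 / (4 * s\<^sup>2), - u2 / (4 * s\<^sup>2), 1 / (2 * s), 0]"
          and ?f2.0 = "e 1" and ?f3.0 = "e 2" and ?f4.0 = "vector [u2 / (4 * s\<^sup>2), u1 / (4 * s\<^sup>2), 0, 1 / (2 * s)]"])
      (simp_all add: frame_simps,
        use assms(2) in \<open>auto simp: axis_def power2_eq_square\<close>)

lemma listed_d4_two_1:
  assumes "lie_algebra (std_br 0 0 0 0 (- s) s (3 * s) 0 u1 u2 (- 2 * s))" and "s \<noteq> 0"
  shows "listed (std_br 0 0 0 0 (- s) s (3 * s) 0 u1 u2 (- 2 * s)) J0"
  by (rule listedI[OF assms(1) d4_two_1, where ?f1.0 = "e 2"
          and ?f2.0 = "vector [- u1 / (4 * s\<^sup>2), - u2 / (12 * s\<^sup>2), 1 / (2 * s), 0]" and ?f3.0 = "- e 1"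
          and ?f4.0 = "vector [u2 / (12 * s\<^sup>2), - u1 / (4 * s\<^sup>2), 0, 1 / (2 * s)]"])
      (simp_all add: frame_simps,
        use assms(2) in \<open>auto simp: axis_def power2_eq_square\<close>)

text \<open>The plane of \<open>f, g\<close> is an algebra under \<open>x \<cdot> y = [J x, y]\<close> with unit \<open>f\<close> and \<open>g \<cdot> g = f\<close>.
  The idempotents \<open>(f \<plusminus> g) / 2\<close> split it into two lines, and each of them gives a copy of
  \<open>aff(\<real>)\<close>. The signs arise because in the model \<open>[J e\<^sub>2, e\<^sub>2] = - e\<^sub>2\<close>.\<close>

lemma listed_split_algebra:
  assumes lie: "lie_algebra br"
    and f: "br (J0 f) f = f" "br (J0 f) g = g" "br (J0 g) f = g" "br (J0 g) g = f"
      "br f g = 0" "br (J0 f) (J0 g) = 0"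
    and indep: "\<And>a b c d. a *\<^sub>R f + b *\<^sub>R J0 f + c *\<^sub>R g + d *\<^sub>R J0 g = 0 \<Longrightarrow>
      a = 0 \<and> b = 0 \<and> c = 0 \<and> d = 0"
  shows "listed br J0"
proof -
  have bil: "bilinear br" "\<And>x. br x x = 0" using lie by (auto simp: lie_algebra_def)
  note sw = alternating_swap[OF bil]
  note rules = bilinear_ladd[OF bil(1)] bilinear_radd[OF bil(1)] bilinear_lmul[OF bil(1)]
    bilinear_rmul[OF bil(1)] bilinear_lsub[OF bil(1)] bilinear_rsub[OF bil(1)]
    bilinear_lneg[OF bil(1)] bilinear_rneg[OF bil(1)]
  define F G where "F = J0 f" and "G = J0 g"
  note f = f[folded F_def G_def]
  have f': "br f F = - f" "br g F = - g" "br f G = - g" "br g G = - f" "br g f = 0" "br G F = 0"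
    using f by (simp_all add: sw[of f F] sw[of g F] sw[of f G] sw[of g G] sw[of g f] sw[of G F])
  have inj: "x$1 = 0 \<and> x$2 = 0 \<and> x$3 = 0 \<and> x$4 = 0"
    if "frame4 ((1/2) *\<^sub>R (F + G)) ((-1/2) *\<^sub>R (f + g)) ((1/2) *\<^sub>R (F - G)) ((-1/2) *\<^sub>R (f - g)) x = 0"
      (is "?P x = 0") for x
  proof -
    have "?P x = (- (x$2 + x$4) / 2) *\<^sub>R f + ((x$1 + x$3) / 2) *\<^sub>R F
        + ((x$4 - x$2) / 2) *\<^sub>R g + ((x$1 - x$3) / 2) *\<^sub>R G"
      by (simp add: frame4_def algebra_simps add_divide_distrib diff_divide_distrib)
    then show ?thesis
      using that indep[of "- (x$2 + x$4) / 2" "(x$1 + x$3) / 2" "(x$4 - x$2) / 2" "(x$1 - x$3) / 2"]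
      unfolding F_def[symmetric] G_def[symmetric] by simp
  qed
  show ?thesis
    by (rule listedI[OF lie aff_aff inj])
      (assumption, simp_all add: frame4_def J_explicit br_aff_aff_def ew_def,
       simp_all add: axis_def rules f f' bil(2),
       simp_all add: vec_eq_iff forall_4 F_def G_def field_simps)
qed

text \<open>With \<open>g \<cdot> g = - f\<close> the algebra is the field of complex numbers.\<close>

lemma listed_complex_algebra:
  assumes lie: "lie_algebra br"
    and f: "br (J0 f) f = f" "br (J0 f) g = g" "br (J0 g) f = g" "br (J0 g) g = - f"
      "br f g = 0" "br (J0 f) (J0 g) = 0"
    and indep: "\<And>a b c d. a *\<^sub>R f + b *\<^sub>R J0 f + c *\<^sub>R g + d *\<^sub>R J0 g = 0 \<Longrightarrow>
      a = 0 \<and> b = 0 \<and> c = 0 \<and> d = 0"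
  shows "listed br J0"
proof -
  have bil: "bilinear br" "\<And>x. br x x = 0" using lie by (auto simp: lie_algebra_def)
  note rules = bilinear_lneg[OF bil(1)] bilinear_rneg[OF bil(1)]
  define F G where "F = J0 f" and "G = J0 g"
  have JF: "J0 F = - f" "J0 G = - g" "J0 (- f) = - F" "J0 (- g) = - G"
    by (simp_all add: F_def G_def vec_eq_iff forall_4)
  have inj: "x$1 = 0 \<and> x$2 = 0 \<and> x$3 = 0 \<and> x$4 = 0" if "frame4 F G (- f) (- g) x = 0" for x
    using that indep[of "- x$3" "x$1" "- x$4" "x$2"]
    by (simp add: frame4_def F_def[symmetric] G_def[symmetric] algebra_simps)
  show ?thesis
    by (rule listedI[OF lie affC_1 inj])
      (assumption, simp_all only: JF J_13_24, simp_all add: frame4_def br_affC_def ew_def,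
       simp_all add: axis_def rules f[folded F_def G_def])
qed

text \<open>Rescaling \<open>g\<close> leaves only the sign of \<open>c\<close>.\<close>

lemma listed_algebra:
  assumes lie: "lie_algebra br"
    and f: "br (J0 f) f = f" "br (J0 f) g = g" "br (J0 g) f = g" "br (J0 g) g = c *\<^sub>R f"
      "br f g = 0" "br (J0 f) (J0 g) = 0" and c: "c \<noteq> 0"
    and indep: "\<And>x y z t. x *\<^sub>R f + y *\<^sub>R J0 f + z *\<^sub>R g + t *\<^sub>R J0 g = 0 \<Longrightarrow> x = 0 \<and> y = 0 \<and> z = 0 \<and> t = 0"
  shows "listed br J0"
proof -
  have bil: "bilinear br" using lie by (auto simp: lie_algebra_def)
  define r where "r = 1 / sqrt \<bar>c\<bar>"
  have r: "r \<noteq> 0" "r * r * c = sgn c" using c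
    by (auto simp: r_def sgn_if field_simps real_sqrt_mult_self)
  have J: "J0 (r *\<^sub>R g) = r *\<^sub>R J0 g" by (simp add: vec_eq_iff forall_4)
  have h: "br (J0 f) (r *\<^sub>R g) = r *\<^sub>R g" "br (J0 (r *\<^sub>R g)) f = r *\<^sub>R g"
    "br (J0 (r *\<^sub>R g)) (r *\<^sub>R g) = sgn c *\<^sub>R f" "br f (r *\<^sub>R g) = 0" "br (J0 f) (J0 (r *\<^sub>R g)) = 0"
    unfolding J using f r(2) by (simp_all add: bilinear_lmul[OF bil] bilinear_rmul[OF bil])
  have ind: "x = 0 \<and> y = 0 \<and> z = 0 \<and> t = 0"
    if "x *\<^sub>R f + y *\<^sub>R J0 f + z *\<^sub>R (r *\<^sub>R g) + t *\<^sub>R J0 (r *\<^sub>R g) = 0" for x y z t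
    using indep[of x y "z * r" "t * r"] that r(1) unfolding J by simp
  show ?thesis
  proof (cases "c > 0")
    case True
    then have "br (J0 (r *\<^sub>R g)) (r *\<^sub>R g) = f" using h(3) by simp
    from listed_split_algebra[OF lie f(1) h(1,2) this h(4,5) ind] show ?thesis by blast
  next
    case False
    then have "br (J0 (r *\<^sub>R g)) (r *\<^sub>R g) = - f" using h(3) c by simp
    from listed_complex_algebra[OF lie f(1) h(1,2) this h(4,5) ind] show ?thesis by blast
  qed
qed

lemma listed_algebra_1:
  assumes "lie_algebra (std_br q 0 0 0 s s s 0 0 0 (2 * s))" and "s \<noteq> 0" "q \<noteq> 0"
  shows "listed (std_br q 0 0 0 s s s 0 0 0 (2 * s)) J0"
  by (rule listed_algebra[OF assms(1), where f = "vector [0, 0, 1 / (2 * s), 0]" and g = "e 2" and c = "- 2 * s * q"])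
      (simp_all add: frame_simps,
        use assms(2,3) in \<open>simp_all add: axis_def\<close>)

text \<open>The algebra is the plane of \<open>e\<^sub>1, e\<^sub>3\<close>. Its unit \<open>y e\<^sub>1 + x e\<^sub>3\<close> solves a linear system with
  determinant proportional to \<open>p + 2 n\<close>, the trace of \<open>ad e\<^sub>4\<close>; multiplication by \<open>e\<^sub>1\<close> is
  traceless, so \<open>e\<^sub>1\<close> squares to a multiple of the unit.\<close>

lemma listed_algebra_2:
  assumes "lie_algebra (std_br (- 2 * \<kappa> * n) 0 (- \<kappa> * u) 0 n (- n) n 0 u 0 p)" and "n \<noteq> 0" "\<kappa> \<noteq> 0"
    and k: "\<kappa> * u\<^sup>2 = n * (p - 2 * n)" and p: "p + 2 * n \<noteq> 0"
  shows "listed (std_br (- 2 * \<kappa> * n) 0 (- \<kappa> * u) 0 n (- n) n 0 u 0 p) J0"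
proof -
  define x y where "x = 2 / (p + 2 * n)" and "y = - u / (n * (p + 2 * n))"
  have np: "n * (p + 2 * n) \<noteq> 0" using p \<open>n \<noteq> 0\<close> by simp
  then have h: "x * (p + 2 * n) = 2" "y * (n * (p + 2 * n)) = - u"
    using nonzero_eq_divide_eq[of _ x] nonzero_eq_divide_eq[of _ y] p x_def y_def by blast+
  then have x0: "x \<noteq> 0" by auto
  have "(p + 2 * n) * (x * u + 2 * n * y) = u * (x * (p + 2 * n)) + 2 * (y * (n * (p + 2 * n)))"
    by (simp add: algebra_simps)
  also have "\<dots> = 0" unfolding h by simp
  finally have B: "x * u + 2 * n * y = 0" using p by (simp only: mult_eq_0_iff) simp
  have "(n * (p + 2 * n)) * (2 * n * x - \<kappa> * u * y) =
      2 * n * n * (x * (p + 2 * n)) - \<kappa> * u * (y * (n * (p + 2 * n)))"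
    by (simp add: algebra_simps)
  also have "\<dots> = 4 * n\<^sup>2 + \<kappa> * u\<^sup>2" unfolding h by (simp add: power2_eq_square)
  also have "\<dots> = n * (p + 2 * n) * 1" unfolding k by (simp add: power2_eq_square algebra_simps)
  finally have A: "2 * n * x - \<kappa> * u * y = 1" using np mult_left_cancel by blast
  have C: "x * p + \<kappa> * u * y = 1" using h(1) A by (simp add: algebra_simps)
  have goals: "4 * (n * (x * y)) - y * y * (\<kappa> * u) + x * x * u = y"
    "2 * (\<kappa> * (u * (x * y))) + y * y * (2 * \<kappa> * n) + x * x * p = x"
    "x * (2 * n) - y * (\<kappa> * u) = 1" "y * (2 * \<kappa> * n) + x * (\<kappa> * u) = 0"
    "- (\<kappa> * u) = \<kappa> * n * (p + 2 * n) * y" "(p + 2 * n) * x = 2"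
    using A B C h by algebra+
  show ?thesis
    by (rule listed_algebra[OF assms(1), where f = "vector [y, 0, x, 0]" and g = "e 1" and c = "\<kappa> * n * (p + 2 * n)"])
      (simp_all add: frame_simps,
        use assms(2,3) in \<open>simp_all add: axis_def\<close>,
        (intro conjI goals)+,
        rule p,
        use x0 in auto)
qed

section \<open>The classification\<close>

lemma listed_orthogonal:
  assumes lie: "lie_algebra (std_br q b1 b2 r n s a1 a2 u1 u2 p)"
    and nonab: "\<not> abelian (std_br q b1 b2 r n s a1 a2 u1 u2 p)"
    and k: "\<kappa> \<noteq> 0" "r = 0" "b1 = \<kappa> * u2" "b2 = - \<kappa> * u1" "q = - 2 * \<kappa> * a1" "s * n \<le> 0"
  shows "listed (std_br q b1 b2 r n s a1 a2 u1 u2 p) J0" (is "listed ?b _")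
proof -
  note j = std_br_jacobi[OF lie, unfolded k(2-5)]
  have "\<kappa> * (\<kappa> * (u1\<^sup>2 + u2\<^sup>2)) = \<kappa> * (a1 * (p - 2 * a1))" using j(1) by algebra
  then have 1: "\<kappa> * (u1\<^sup>2 + u2\<^sup>2) = a1 * (p - 2 * a1)" using k(1) by simp
  have "\<kappa> * ((n - 3 * a1 - 2 * s) * u1) = \<kappa> * (a2 * u2)" using j(2) by algebra
  then have 2: "(n - 3 * a1 - 2 * s) * u1 = a2 * u2" using k(1) by simp
  have "\<kappa> * ((n - 3 * a1 + 2 * s) * u2) = \<kappa> * (- a2 * u1)" using j(3) by algebra
  then have 3: "(n - 3 * a1 + 2 * s) * u2 = - a2 * u1" using mult_left_cancel[OF k(1)] by blast
  have 4: "2 * s\<^sup>2 + \<kappa> * (u1\<^sup>2 + u2\<^sup>2) = p * n" using j(4) by (simp add: power2_eq_square algebra_simps)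
  have 5: "(2 * n - p) * s = \<kappa> * (u1\<^sup>2 - u2\<^sup>2)" using j(6) by algebra
  have 6: "a2 * s = \<kappa> * u1 * u2" using j(5) by algebra
  from orthogonal_solutions[OF k(1,6) 1 2 3 4 5 6]
  consider (a) "u1 = 0" "u2 = 0" "s = 0" "p = 0" "a1 = 0"
    | (b) "u1 = 0" "u2 = 0" "s = 0" "p \<noteq> 0" "n = 0" "a1 = 0"
    | (c) "u1 = 0" "u2 = 0" "s = 0" "p \<noteq> 0" "n = 0" "p = 2 * a1"
    | (d) "u1 = 0" "u2 = 0" "n \<noteq> 0" "s = - n" "p = 2 * n" "a1 = 0" "a2 = 0"
    | (e) "n \<noteq> 0" "s = - n" "a1 = n" "a2 = 0" "u2 = 0" "\<kappa> * u1\<^sup>2 = n * (p - 2 * n)"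
    by blast
  then show ?thesis
  proof cases
    case a
    then have b: "?b = std_br 0 0 0 0 n 0 0 a2 0 0 0" using k by simp
    have "n \<noteq> 0 \<or> a2 \<noteq> 0"
    proof (rule ccontr)
      assume "\<not> ?thesis"
      then have "abelian ?b" unfolding b abelian_def by (simp add: std_br_def vec_eq_iff forall_4)
      then show False using nonab by blast
    qed
    then show ?thesis using listed_re2 lie unfolding b by blast
  next
    case b
    then have b: "?b = std_br 0 0 0 0 0 0 0 a2 0 0 p" using k by simp
    show ?thesis
      using lie listed_rr_aff[of p] listed_r4'[of a2 p] \<open>p \<noteq> 0\<close> unfolding b by (cases "a2 = 0") auto
  next
    case c
    then have b: "?b = std_br q 0 0 0 0 0 a1 a2 0 0 (2 * a1)" and "q \<noteq> 0" "a1 \<noteq> 0" using k by auto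
    then show ?thesis
      using lie listed_d4_half[of q a1] listed_d4'[of q a1 a2] unfolding b by (cases "a2 = 0") auto
  next
    case d
    then have b: "?b = std_br 0 0 0 0 n (- n) 0 0 0 0 (2 * n)" using k by simp
    show ?thesis using listed_d4_two_2[of n] lie d unfolding b by blast
  next
    case e
    then have b: "?b = std_br (- 2 * \<kappa> * n) 0 (- \<kappa> * u1) 0 n (- n) n 0 u1 0 p" using k by simp
    show ?thesis
    proof (cases "p + 2 * n = 0")
      case True
      then have p: "p = - 2 * n" by simp
      have "\<kappa> * u1\<^sup>2 = - 4 * n\<^sup>2" using e(6) unfolding p by (simp add: power2_eq_square)
      then show ?thesis using listed_rh3_3[of \<kappa> n u1] lie[unfolded b] e(1) unfolding b by (simp only: p simp_thms)
    next
      case False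
      then show ?thesis using listed_algebra_2[of \<kappa> n u1 p] lie e k(1) unfolding b by blast
    qed
  qed
qed

lemma listed_isotropic:
  assumes lie: "lie_algebra (std_br q b1 b2 r n s a1 a2 u1 u2 p)"
    and nonab: "\<not> abelian (std_br q b1 b2 r n s a1 a2 u1 u2 p)"
    and k: "b1 = 0" "a2 = 2 * r" "p = n + 2 * s - a1" "q \<noteq> 0 \<Longrightarrow> b2 = 0"
  shows "listed (std_br q b1 b2 r n s a1 a2 u1 u2 p) J0" (is "listed ?b _")
proof -
  have b2: "b2 = 0" using k(4) std_br_jacobi(1)[OF lie] k(1) by (cases "q = 0") auto
  note j = std_br_jacobi[OF lie, unfolded k(1,2) b2]
  have qu: "q * u1 = 0" "q * u2 = 0" and 1: "q * (p - 2 * a1) = 0" using j(1,2,3) by auto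
  have 4: "2 * (r\<^sup>2 + s\<^sup>2) = p * n" using j(4) by simp
  have 5: "2 * (n * r - 2 * r * s) = p * r" using j(5) by simp
  have 6: "2 * (n * s + 2 * r * r) = p * s" using j(6) by simp
  note sol = isotropic_solutions[OF k(3) 1 4 5 6]
  have z: "r = 0" "a2 = 0" using sol(1) k(2) by auto
  from sol(2)
  consider (a) "s = 0" "n = 0" "p = - a1" "q = 0" "a1 \<noteq> 0" | (b) "s = 0" "n = 0" "p = 0" "a1 = 0"
    | (c) "s = 0" "n = a1" "n \<noteq> 0" "p = 0" "q = 0"
    | (d) "s \<noteq> 0" "a1 = s" "n = s" "p = 2 * s"
    | (e) "s \<noteq> 0" "a1 = 3 * s" "n = - s" "p = - 2 * s" "q = 0"
    by fastforce
  then show ?thesis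
  proof cases
    case a
    then have b: "?b = std_br 0 0 0 0 0 0 a1 0 u1 u2 (- a1)" using k z b2 by simp
    show ?thesis using listed_r4[of a1 u1 u2] lie a unfolding b by blast
  next
    case b
    then have b: "?b = std_br q 0 0 0 0 0 0 0 u1 u2 0" using k z b2 by simp
    show ?thesis
    proof (cases "q = 0")
      case True
      have "u1 \<noteq> 0 \<or> u2 \<noteq> 0"
      proof (rule ccontr)
        assume "\<not> ?thesis"
        then have "abelian ?b" unfolding b abelian_def by (simp add: True std_br_def vec_eq_iff forall_4)
        then show False using nonab by blast
      qed
      then show ?thesis using listed_rh3_2[of u1 u2] lie[unfolded b] unfolding b by (simp only: True)
    next
      case False
      then have "u1 = 0" "u2 = 0" using qu by auto
      then show ?thesis using listed_rh3_1[of q] lie False unfolding b by simp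
    qed
  next
    case c
    then have b: "?b = std_br 0 0 0 0 n 0 n 0 u1 u2 0" using k z b2 by simp
    show ?thesis using listed_affC_2[of n u1 u2] lie c unfolding b by blast
  next
    case d
    then have b: "?b = std_br q 0 0 0 s s s 0 u1 u2 (2 * s)" using k z b2 by simp
    show ?thesis
    proof (cases "q = 0")
      case True
      then show ?thesis using listed_d4_one[of s u1 u2] lie d unfolding b by simp
    next
      case False
      then have "u1 = 0" "u2 = 0" using qu by auto
      then show ?thesis using listed_algebra_1[of q s] lie False d unfolding b by simp
    qed
  next
    case e
    then have b: "?b = std_br 0 0 0 0 (- s) s (3 * s) 0 u1 u2 (- 2 * s)" using k(1) z b2 by simp
    show ?thesis using listed_d4_two_1[of s u1 u2] lie e unfolding b by blast
  qed
qed

lemma equivalent_trans: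
  assumes "equivalent br1 J1 br2 J2" "equivalent br2 J2 br3 J3" shows "equivalent br1 J1 br3 J3"
proof -
  obtain f where f: "linear f" "bij f" "\<And>x y. f (br1 x y) = br2 (f x) (f y)" "\<And>x. J2 (f x) = f (J1 x)"
    using assms(1) unfolding equivalent_def by blast
  obtain g where g: "linear g" "bij g" "\<And>x y. g (br2 x y) = br3 (g x) (g y)" "\<And>x. J3 (g x) = g (J2 x)"
    using assms(2) unfolding equivalent_def by blast
  show ?thesis unfolding equivalent_def
    using linear_compose[OF f(1) g(1)] bij_comp[OF f(2) g(2)] f(3,4) g(3,4)
    by (intro exI[of _ "g \<circ> f"]) simp
qed

lemma abelian_equivalent:
  assumes "equivalent br1 J1 br2 J2" "abelian br2" shows "abelian br1"
proof -
  obtain f where f: "linear f" "bij f" "\<And>x y. f (br1 x y) = br2 (f x) (f y)"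
    using assms(1) unfolding equivalent_def by blast
  have "f (br1 x y) = f 0" for x y using f(3) assms(2) linear_0[OF f(1)] by (simp add: abelian_def)
  then show ?thesis using f(2) unfolding abelian_def by (metis bij_is_inj injD)
qed

lemma classification_real4:
  fixes br :: "real^4 \<Rightarrow> real^4 \<Rightarrow> real^4"
  assumes K: "kaehler br J \<omega>" and nonab: "\<not> abelian br"
  shows "listed br J"
proof -
  obtain br' \<omega>' where K': "kaehler br' J0 \<omega>'" and eq: "equivalent br J br' J0" and
     std: "\<And>x y. br' x y $ 4 = 0" "ad_trace br' (e 1) = 0" "ad_trace br' (e 2) = 0" "ad_trace br' (e 3) = 0" and
     cases: "\<omega>' (e 1) (e 2) \<noteq> 0 \<and> \<omega>' (e 3) (e 1) = 0 \<and> \<omega>' (e 3) (e 2) = 0 \<and> \<omega>' (br' (e 3) (e 1)) (e 2) = 0 \<and>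
      (\<omega>' (e 1) (br' (e 3) (e 1)))\<^sup>2 \<le> (\<omega>' (e 2) (br' (e 3) (e 2)))\<^sup>2 \<or>
     \<omega>' (e 1) (e 2) = 0 \<and> \<omega>' (e 3) (e 1) = 1 \<and> \<omega>' (e 3) (e 2) = 0 \<and> \<omega>' (e 3) (e 4) = 0 \<and>
      (\<omega>' (br' (e 1) (e 2)) (e 1) \<noteq> 0 \<longrightarrow> \<omega>' (br' (e 1) (e 2)) (e 3) = 0)"
    using normal_form_exists[OF K] by blast
  obtain q b1 b2 r n s a1 a2 u1 u2 p where b: "br' = std_br q b1 b2 r n s a1 a2 u1 u2 p"
    using std_br_exists[OF K' std] by blast
  have lie: "lie_algebra (std_br q b1 b2 r n s a1 a2 u1 u2 p)" using K' by (simp add: kaehler_def b)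
  have nonab': "\<not> abelian (std_br q b1 b2 r n s a1 a2 u1 u2 p)"
    using abelian_equivalent[OF eq] nonab b by blast
  from cases have "listed br' J0"
  proof (elim disjE conjE)
    assume "\<omega>' (e 1) (e 2) \<noteq> 0" "\<omega>' (e 3) (e 1) = 0" "\<omega>' (e 3) (e 2) = 0" "\<omega>' (br' (e 3) (e 1)) (e 2) = 0"
      "(\<omega>' (e 1) (br' (e 3) (e 1)))\<^sup>2 \<le> (\<omega>' (e 2) (br' (e 3) (e 2)))\<^sup>2"
    from std_br_orthogonal[OF b K' this] obtain \<kappa> where
      "\<kappa> \<noteq> 0" "r = 0" "b1 = \<kappa> * u2" "b2 = - \<kappa> * u1" "q = - 2 * \<kappa> * a1" "s * n \<le> 0" by blast
    from listed_orthogonal[OF lie nonab' this] show ?thesis by (simp only: b)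
  next
    assume "\<omega>' (e 1) (e 2) = 0" "\<omega>' (e 3) (e 1) = 1" "\<omega>' (e 3) (e 2) = 0" "\<omega>' (e 3) (e 4) = 0"
      "\<omega>' (br' (e 1) (e 2)) (e 1) \<noteq> 0 \<longrightarrow> \<omega>' (br' (e 1) (e 2)) (e 3) = 0"
    note iso = std_br_isotropic[OF b K' this]
    show ?thesis unfolding b by (rule listed_isotropic[OF lie nonab' iso(1-3)]) (rule iso(4))
  qed
  then show ?thesis unfolding listed_def using equivalent_trans[OF eq] by blast
qed

lemma linear_coordinates_exist:
  assumes "dim (UNIV :: 'a::real_vector set) = 4"
  shows "\<exists>P :: real^4 \<Rightarrow> 'a. linear P \<and> bij P"
proof -
  obtain B :: "'a set" where B: "independent B" "UNIV \<subseteq> span B" "card B = 4"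
    using basis_exists[of "UNIV :: 'a set"] assms by metis
  have fin: "finite B" using B(3) card.infinite by fastforce
  obtain h :: "4 \<Rightarrow> 'a" where h: "bij_betw h UNIV B"
    using finite_same_card_bij[of "UNIV :: 4 set" B] fin B(3) by auto
  define P where "P x = (\<Sum>i\<in>UNIV. x$i *\<^sub>R h i)" for x :: "real^4"
  have lin: "linear P"
    by (rule linearI) (simp_all add: P_def scaleR_left_distrib sum.distrib scaleR_sum_right)
  have conv: "P (\<chi> i. u (h i)) = (\<Sum>v\<in>B. u v *\<^sub>R v)" for u
    using sum.reindex_bij_betw[OF h, of "\<lambda>v. u v *\<^sub>R v"] by (simp add: P_def)
  have "x = 0" if x: "P x = 0" for x
  proof -
    define u where "u v = x $ (inv_into UNIV h v)" for v
    have u: "u (h i) = x $ i" for i using h by (simp add: u_def bij_betw_def)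
    have "(\<Sum>v\<in>B. u v *\<^sub>R v) = 0" using x conv[of u] by (simp add: u)
    then have "u (h i) = 0" for i
      using independentD[OF B(1) fin order_refl] h bij_betwE by blast
    then show ?thesis by (simp add: u vec_eq_iff)
  qed
  then have "inj P" using linear_injective_0[OF lin] by blast
  moreover have "y \<in> range P" for y
  proof -
    have "y \<in> range (\<lambda>u. \<Sum>v\<in>B. u v *\<^sub>R v)" using B(2) span_finite[OF fin] by blast
    then show ?thesis using conv by (metis (no_types, lifting) imageE rangeI)
  qed
  ultimately show ?thesis using lin unfolding bij_def by blast
qed

theorem proposition3p3:
  shows "(\<forall>(br :: 'a::real_vector \<Rightarrow> 'a \<Rightarrow> 'a) (J :: 'a \<Rightarrow> 'a).
            dim (UNIV :: 'a set) = 4 \<and> \<not> abelian br \<and> (\<exists>\<omega>. kaehler br J \<omega>) \<longrightarrow>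
            (\<exists>br' J' \<Omega>. kaehler_model br' J' \<Omega> \<and> equivalent br J br' J')) \<and>
         (\<forall>br J \<Omega>. kaehler_model br J \<Omega> \<longrightarrow>
            lie_algebra br \<and> complex_structure br J \<and>
            {\<omega>. symplectic_structure br \<omega> \<and> compatible J \<omega>} = \<Omega>)"
proof (intro conjI allI impI)
  fix br :: "'a \<Rightarrow> 'a \<Rightarrow> 'a" and J
  assume A: "dim (UNIV :: 'a set) = 4 \<and> \<not> abelian br \<and> (\<exists>\<omega>. kaehler br J \<omega>)"
  then obtain \<omega> where K: "kaehler br J \<omega>" by blast
  obtain P :: "real^4 \<Rightarrow> 'a" where P: "linear P" "bij P" using linear_coordinates_exist A by blast
  note T = kaehler_transfer[OF P K]
  have "\<not> abelian (\<lambda>x y. inv P (br (P x) (P y)))"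
    using abelian_equivalent[OF T(2)] A by blast
  from classification_real4[OF T(1) this] show "\<exists>br' J' \<Omega>. kaehler_model br' J' \<Omega> \<and> equivalent br J br' J'"
    unfolding listed_def using equivalent_trans[OF T(2)] by blast
next
  fix br J \<Omega> assume m: "kaehler_model br J \<Omega>"
  then show "lie_algebra br" by cases (simp_all add: lie_models)
  show c: "complex_structure br J" by (rule model_complex[OF m])
  show "{\<omega>. symplectic_structure br \<omega> \<and> compatible J \<omega>} = \<Omega>"
    by (rule model_forms[OF m]) (use c in \<open>simp add: complex_structure_def\<close>)
qed

end
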